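(* For all sufficiently large $n$ and every $2\le d\le n^{1/2}$, $$t_3(n,d,2)\le n\,d^{-2}(\log d)^{O(1)}.$$
   Context: A $3$-graph ($3$-uniform hypergraph) is a pair $H=(V(H),E(H))$ with $V(H)$ a finite set and $E(H)\subseteq\binom{V(H)}{3}$; $e(H)=|E(H)|$. A $3$-graph $F$ is a subhypergraph of $H$ if $V(F)\subseteq V(H)$ and $E(F)\subseteq E(H)$. The average degree of a nonempty $3$-graph $H$ is $\overline d(H)=3\,e(H)/|V(H)|$. For real numbers $d\ge s>1$, where $d$ is allowed to depend on $n$, $t_3(n,d,s)$ denotes the smallest integer $t$ such that every $n$-vertex $3$-graph $H$ with $\overline d(H)\ge d$ contains a nonempty subhypergraph $H'$ with $|V(H')|\le t$ and $\overline d(H')\ge s$. The exponent $O(1)$ denotes a quantity bounded by an absolute constant, independent of $n$ and $d$.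
   Formalization: The bound is stated as A·n·d^{-2}(ln d)^C with absolute constants A and C; without the factor A it fails at d = 2, where t_3(n,2,2) = n for infinitely many n, and for d ≥ 3 the factor can be absorbed into the exponent. *)

theory Defs
  imports Complex_Main "HOL-Library.Ramsey"
begin

(* A hypergraph is the pair of its vertex set and its edge set. *)
type_synonym 'a hypergraph = "'a set \<times> 'a set set"

abbreviation verts :: "'a hypergraph \<Rightarrow> 'a set" where
  "verts H \<equiv> fst H"

abbreviation edges :: "'a hypergraph \<Rightarrow> 'a set set" where
  "edges H \<equiv> snd H"

definition three_graph :: "'a hypergraph \<Rightarrow> bool" where
  "three_graph H \<longleftrightarrow> finite (verts H) \<and> edges H \<subseteq> nsets (verts H) 3"

definition subhypergraph :: "'a hypergraph \<Rightarrow> 'a hypergraph \<Rightarrow> bool" where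
  "subhypergraph F H \<longleftrightarrow> three_graph F \<and> verts F \<subseteq> verts H \<and> edges F \<subseteq> edges H"

definition avg_degree :: "'a hypergraph \<Rightarrow> real" where
  "avg_degree H = 3 * real (card (edges H)) / real (card (verts H))"

(* Vertices are natural numbers: every finite 3-graph is isomorphic to one of these.
   For n > 0 and d \<ge> s the value n is admissible, so the minimum is over a nonempty set.
   If some n-vertex 3-graph has average degree at least d, then every admissible integer is
   positive, so minimising over nat is the same as minimising over the integers. *)
definition t3 :: "nat \<Rightarrow> real \<Rightarrow> real \<Rightarrow> nat" where
  "t3 n d s = (LEAST t. \<forall>H :: nat hypergraph.
     three_graph H \<and> card (verts H) = n \<and> avg_degree H \<ge> d \<longrightarrow>
     (\<exists>H'. subhypergraph H' H \<and> verts H' \<noteq> {} \<and> card (verts H') \<le> t \<and> avg_degree H' \<ge> s))"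

end

(*
  Choosing a pair inside every triple turns a 3-graph into a graph: 2|W| triples whose chosen pairs
  lie in W span at most 3|W| vertices. If some pair lies in four triples, these already suffice;
  otherwise the graph keeps a third of the edges, and it remains to find a set W of at most
  n d^(-2) (log d)^O(1) vertices spanning at least 2|W| edges.

  Pass to minimum degree of order d and colour the vertices randomly with about log log d layers.
  Choose a random subset S of layer 0 with density p = d^(-2) (log d)^O(1), and call a vertex of a
  higher layer good if it has a good neighbour in each of two fixed halves of its neighbourhood in
  the previous layer. Every good vertex is the root of a binary tree with leaves in S, and each
  vertex of the tree outside S has two edges downwards. A set W closed under this spans at least
  2|W| - 2|S| edges, so it is enough to gain 2|S| further edges from vertices with more than two good
  neighbours below. If the expected gain is small, good neighbours do not cluster, so a
  neighbourhood of size d meets the good vertices with probability about d q when a vertex below is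
  good with probability q. By Harris' inequality a vertex is then good with probability about
  (d q)^2, up to exceptional vertices of small total degree. Hence d^2 q is squared at every layer,
  which forces a probability above 1.
*)
theory Submission
  imports Defs
begin

subsection \<open>Random subsets and random colourings\<close>

text \<open>Expectation of \<open>f\<close> at a random subset of \<open>A\<close> that keeps each
  element independently with probability \<open>p\<close>. As a finite sum it can be handled by
  induction on \<open>A\<close>, without measure theory.\<close>

definition biased_ex :: "real \<Rightarrow> 'a set \<Rightarrow> ('a set \<Rightarrow> real) \<Rightarrow> real" where
  "biased_ex p A f = (\<Sum>S\<in>Pow A. p ^ card S * (1 - p) ^ card (A - S) * f S)"

lemma biased_ex_empty [simp]: "biased_ex p {} f = f {}"
  by (simp add: biased_ex_def)

text \<open>Conditioning on whether the random set contains \<open>a\<close>; the inductions on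
  \<open>A\<close> below rest on this.\<close>

lemma biased_ex_insert:
  assumes "finite A" "a \<notin> A"
  shows "biased_ex p (insert a A) f
    = (1 - p) * biased_ex p A f + p * biased_ex p A (\<lambda>S. f (insert a S))"
proof -
  have inj: "inj_on (insert a) (Pow A)"
    using assms(2) by (intro inj_onI) (metis Diff_insert_absorb PowD insert_absorb insert_ident subsetD)
  have fin: "finite S" if "S \<in> Pow A" for S
    using that assms(1) finite_subset by auto
  have 1: "insert a A - S = insert a (A - S)" "a \<notin> A - S" if "S \<in> Pow A" for S
    using that assms(2) by auto
  have 2: "insert a A - insert a S = A - S" "a \<notin> S" if "S \<in> Pow A" for S
    using that assms(2) by auto
  have disj: "Pow A \<inter> insert a ` Pow A = {}"
    using assms(2) by auto
  have "biased_ex p (insert a A) f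
    = (\<Sum>S\<in>Pow A. p ^ card S * (1 - p) ^ card (insert a A - S) * f S)
      + (\<Sum>S\<in>insert a ` Pow A. p ^ card S * (1 - p) ^ card (insert a A - S) * f S)"
    unfolding biased_ex_def Pow_insert using assms(1) disj by (intro sum.union_disjoint) auto
  also have "(\<Sum>S\<in>Pow A. p ^ card S * (1 - p) ^ card (insert a A - S) * f S)
    = (1 - p) * biased_ex p A f"
    unfolding biased_ex_def sum_distrib_left
    using assms by (intro sum.cong refl) (auto simp: 1 insert_Diff_if subset_iff)
  also have "(\<Sum>S\<in>insert a ` Pow A. p ^ card S * (1 - p) ^ card (insert a A - S) * f S)
    = p * biased_ex p A (\<lambda>S. f (insert a S))"
    unfolding biased_ex_def sum_distrib_left sum.reindex[OF inj]
    by (intro sum.cong refl) (simp add: 2 fin)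
  finally show ?thesis .
qed

lemma biased_ex_add: "biased_ex p A (\<lambda>S. f S + g S) = biased_ex p A f + biased_ex p A g"
  by (simp add: biased_ex_def algebra_simps sum.distrib)

lemma biased_ex_cmult: "biased_ex p A (\<lambda>S. c * f S) = c * biased_ex p A f"
  by (simp add: biased_ex_def algebra_simps sum_distrib_left)

lemma biased_ex_diff: "biased_ex p A (\<lambda>S. f S - g S) = biased_ex p A f - biased_ex p A g"
  by (simp add: biased_ex_def algebra_simps sum_subtractf)

lemma biased_ex_sum: "biased_ex p A (\<lambda>S. \<Sum>i\<in>I. f i S) = (\<Sum>i\<in>I. biased_ex p A (f i))"
  unfolding biased_ex_def sum_distrib_left by (rule sum.swap)

lemma biased_ex_mono:
  assumes "0 \<le> p" "p \<le> 1" "\<And>S. S \<subseteq> A \<Longrightarrow> f S \<le> g S"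
  shows "biased_ex p A f \<le> biased_ex p A g"
  unfolding biased_ex_def using assms by (intro sum_mono mult_left_mono) auto

lemma biased_ex_const: "finite A \<Longrightarrow> biased_ex p A (\<lambda>_. c) = c"
  by (induction A rule: finite_induct) (simp_all add: biased_ex_insert algebra_simps)

lemma biased_ex_mem:
  assumes "finite A" "a \<in> A"
  shows "biased_ex p A (\<lambda>S. of_bool (a \<in> S)) = p"
proof -
  obtain B where B: "A = insert a B" "a \<notin> B" using assms(2) by (metis mk_disjoint_insert)
  have "biased_ex p B (\<lambda>S. of_bool (a \<in> S)) = biased_ex p B (\<lambda>S. 0)"
    unfolding biased_ex_def using B by (intro sum.cong) auto
  with B assms show ?thesis by (simp add: biased_ex_insert biased_ex_const)
qed

lemma biased_ex_card:
  assumes "finite A"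
  shows "biased_ex p A (\<lambda>S. real (card S)) = p * real (card A)"
proof -
  have "biased_ex p A (\<lambda>S. real (card S)) = biased_ex p A (\<lambda>S. \<Sum>a\<in>A. of_bool (a \<in> S))"
  proof -
    have "real (card S) = (\<Sum>a\<in>A. of_bool (a \<in> S))" if "S \<in> Pow A" for S
    proof -
      have "A \<inter> S = S" using that by blast
      with assms show ?thesis by simp
    qed
    then show ?thesis
      unfolding biased_ex_def by (intro sum.cong refl) simp
  qed
  also have "\<dots> = p * real (card A)"
    unfolding biased_ex_sum using assms by (simp add: biased_ex_mem)
  finally show ?thesis .
qed

text \<open>By independence each element contributes a factor \<open>1 - p + p * c\<close>. With
  \<open>c = 3\<close> this is the exponential moment that later keeps the random base set
  small.\<close>

lemma biased_ex_power_card: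
  assumes "finite A"
  shows "biased_ex p A (\<lambda>S. c ^ card S) = (1 - p + p * c) ^ card A"
  using assms
proof (induction A rule: finite_induct)
  case (insert a A)
  have "biased_ex p A (\<lambda>S. c ^ card (insert a S)) = biased_ex p A (\<lambda>S. c * c ^ card S)"
    unfolding biased_ex_def
  proof (intro sum.cong refl)
    fix S assume "S \<in> Pow A"
    then have "finite S" "a \<notin> S" using insert finite_subset by auto
    then show "p ^ card S * (1 - p) ^ card (A - S) * c ^ card (insert a S)
      = p ^ card S * (1 - p) ^ card (A - S) * (c * c ^ card S)" by simp
  qed
  with insert show ?case
    by (simp add: biased_ex_insert biased_ex_cmult algebra_simps)
qed auto

text \<open>Harris' inequality, by conditioning on the membership of \<open>a\<close>. In either
  case the induction hypothesis applies, and from one case to the other both conditional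
  expectations move in the same direction.\<close>

lemma biased_ex_Harris:
  assumes "finite A" "0 \<le> p" "p \<le> 1"
    and "\<And>S T. S \<subseteq> T \<Longrightarrow> T \<subseteq> A \<Longrightarrow> f S \<le> f T"
    and "\<And>S T. S \<subseteq> T \<Longrightarrow> T \<subseteq> A \<Longrightarrow> g S \<le> g T"
  shows "biased_ex p A f * biased_ex p A g \<le> biased_ex p A (\<lambda>S. f S * g S)"
  using assms(1,4,5)
proof (induction A arbitrary: f g rule: finite_induct)
  case (insert a A)
  let ?E = "biased_ex p A"
  let ?f = "\<lambda>S. f (insert a S)" and ?g = "\<lambda>S. g (insert a S)"
  have 0: "?E f * ?E g \<le> ?E (\<lambda>S. f S * g S)"
    by (rule insert.IH; rule insert.prems) auto
  have 1: "?E ?f * ?E ?g \<le> ?E (\<lambda>S. ?f S * ?g S)"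
    by (rule insert.IH; rule insert.prems) auto
  have "?E f \<le> ?E ?f" "?E g \<le> ?E ?g"
    using assms(2,3) by (auto intro!: biased_ex_mono insert.prems)
  \<comment> \<open>This product is the covariance contributed by the element \<open>a\<close>
    alone.\<close>
  then have "0 \<le> (p * (1 - p)) * ((?E ?f - ?E f) * (?E ?g - ?E g))"
    using assms(2,3) by simp
  also have "\<dots> = (1 - p) * (?E f * ?E g) + p * (?E ?f * ?E ?g)
      - ((1 - p) * ?E f + p * ?E ?f) * ((1 - p) * ?E g + p * ?E ?g)"
    by (simp add: algebra_simps)
  also have "(1 - p) * (?E f * ?E g) + p * (?E ?f * ?E ?g)
    \<le> (1 - p) * ?E (\<lambda>S. f S * g S) + p * ?E (\<lambda>S. ?f S * ?g S)"
    using 0 1 assms(2,3) by (intro add_mono mult_left_mono) auto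
  finally show ?case
    using insert by (simp add: biased_ex_insert)
qed auto

section \<open>Uniformly random colourings: first and second moments\<close>

lemma sum_of_bool_real: "finite A \<Longrightarrow> (\<Sum>x\<in>A. of_bool (P x) :: real) = real (card {x\<in>A. P x})"
  by (simp add: Int_def)

text \<open>The colours of two distinct vertices are independent, so the product of centred
  functions of them averages to zero. These are the off-diagonal terms of the variance in
  Chebyshev's inequality.\<close>

lemma colour_correlation:
  fixes V :: "'a set" and y :: "nat \<Rightarrow> real"
  assumes "finite V" "x \<in> V" "z \<in> V" "x \<noteq> z" "(\<Sum>j<m. y j) = 0"
  shows "(\<Sum>c\<in>V \<rightarrow>\<^sub>E {..<m}. y (c x) * y (c z)) = 0"
proof -
  \<comment> \<open>Factors 1 at all other vertices turn the summand into a product over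
    \<open>V\<close>, so the sum over colourings factorises vertex by vertex.\<close>
  let ?F = "\<lambda>u j. if u = x \<or> u = z then y j else 1"
  have "(\<Sum>c\<in>V \<rightarrow>\<^sub>E {..<m}. y (c x) * y (c z)) = (\<Sum>c\<in>V \<rightarrow>\<^sub>E {..<m}. \<Prod>u\<in>V. ?F u (c u))"
  proof (intro sum.cong refl)
    fix c
    have "(\<Prod>u\<in>V. ?F u (c u)) = (\<Prod>u\<in>{x,z}. ?F u (c u))"
      using assms by (intro prod.mono_neutral_right) auto
    then show "y (c x) * y (c z) = (\<Prod>u\<in>V. ?F u (c u))" using assms by simp
  qed
  also have "\<dots> = (\<Prod>u\<in>V. \<Sum>j<m. ?F u j)"
    using assms by (simp add: prod_sum_PiE)
  also have "\<dots> = 0"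
    using assms by (intro prod_zero bexI[of _ x]) auto
  finally show ?thesis .
qed

lemma sum_colour:
  fixes V :: "'a set" and y :: "nat \<Rightarrow> real"
  assumes "finite V" "x \<in> V"
  shows "real m * (\<Sum>c\<in>V \<rightarrow>\<^sub>E {..<m}. y (c x)) = real (card (V \<rightarrow>\<^sub>E {..<m})) * (\<Sum>j<m. y j)"
proof -
  let ?F = "\<lambda>u j. if u = x then y j else 1"
  have "(\<Sum>c\<in>V \<rightarrow>\<^sub>E {..<m}. y (c x)) = (\<Sum>c\<in>V \<rightarrow>\<^sub>E {..<m}. \<Prod>u\<in>V. ?F u (c u))"
    using assms by (intro sum.cong refl) simp
  also have "\<dots> = (\<Prod>u\<in>V. \<Sum>j<m. ?F u j)"
    using assms by (simp add: prod_sum_PiE)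
  also have "\<dots> = (\<Sum>j<m. y j) * (\<Prod>u\<in>V - {x}. \<Sum>j<m. ?F u j)"
    using assms by (simp add: prod.remove[of V x])
  also have "(\<Prod>u\<in>V - {x}. \<Sum>j<m. ?F u j) = real m ^ (card V - 1)"
    using assms by simp
  finally have "real m * (\<Sum>c\<in>V \<rightarrow>\<^sub>E {..<m}. y (c x)) = (\<Sum>j<m. y j) * real m ^ Suc (card V - 1)"
    by simp
  also have "Suc (card V - 1) = card V"
    using assms by (metis Suc_pred' card_gt_0_iff empty_iff)
  finally show ?thesis
    using assms by (simp add: card_PiE)
qed

text \<open>The number of vertices of \<open>N\<close> with colour \<open>i\<close> has mean
  \<open>card N / m\<close> and variance at most that. Falling below half the mean is a deviation of
  \<open>card N / (2 * m)\<close>, and Chebyshev's inequality applies.\<close>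

lemma colour_Chebyshev:
  fixes V :: "'a set"
  assumes "finite V" "N \<subseteq> V" "N \<noteq> {}" "i < m"
  shows "real (card {c \<in> V \<rightarrow>\<^sub>E {..<m}. real (card {x\<in>N. c x = i}) < real (card N) / (2 * real m)})
    \<le> real (card (V \<rightarrow>\<^sub>E {..<m})) * (4 * real m / real (card N))"
proof -
  let ?C = "V \<rightarrow>\<^sub>E {..<m}"
  define n where "n = real (card N)"
  have fN: "finite N" using assms finite_subset by auto
  have n: "n > 0" using assms fN by (simp add: n_def card_gt_0_iff)
  have m: "real m > 0" using assms by simp
  \<comment> \<open>The centred indicator of colour \<open>i\<close>: its sum over \<open>N\<close>
    is the deviation from the mean.\<close>
  define y :: "nat \<Rightarrow> real" where "y j = of_bool (j = i) - 1 / real m" for j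
  have y0: "(\<Sum>j<m. y j) = 0"
    using assms m by (simp add: y_def sum_subtractf)
  have "(\<Sum>j<m. (y j)\<^sup>2) = (\<Sum>j<m. of_bool (j = i) * (1 - 2 / real m) + 1 / (real m)\<^sup>2)"
    using m by (intro sum.cong refl) (auto simp: y_def power2_eq_square field_simps)
  also have "\<dots> = 1 - 1 / real m"
    using assms m by (simp add: sum.distrib power2_eq_square flip: sum_distrib_right)
  finally have y2: "(\<Sum>j<m. (y j)\<^sup>2) \<le> 1" using m by simp
  have var: "(\<Sum>c\<in>?C. (\<Sum>x\<in>N. y (c x))\<^sup>2) \<le> real (card ?C) * (n / real m)"
  proof -
    have "(\<Sum>c\<in>?C. (\<Sum>x\<in>N. y (c x))\<^sup>2) = (\<Sum>c\<in>?C. \<Sum>x\<in>N. \<Sum>z\<in>N. y (c x) * y (c z))"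
      by (simp add: power2_eq_square sum_product)
    also have "\<dots> = (\<Sum>x\<in>N. \<Sum>z\<in>N. \<Sum>c\<in>?C. y (c x) * y (c z))"
      by (subst sum.swap, intro sum.cong refl, rule sum.swap)
    also have "\<dots> = (\<Sum>x\<in>N. \<Sum>z\<in>N. if x = z then \<Sum>c\<in>?C. (y (c x))\<^sup>2 else 0)"
      using assms(2) colour_correlation[OF assms(1) _ _ _ y0]
      by (intro sum.cong refl) (auto simp: power2_eq_square subset_iff)
    also have "\<dots> = (\<Sum>x\<in>N. \<Sum>c\<in>?C. (y (c x))\<^sup>2)"
      using fN by simp
    also have "\<dots> \<le> (\<Sum>x\<in>N. real (card ?C) / real m)"
    proof (rule sum_mono)
      fix x assume "x \<in> N"
      then have "real m * (\<Sum>c\<in>?C. (y (c x))\<^sup>2) = real (card ?C) * (\<Sum>j<m. (y j)\<^sup>2)"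
        using assms by (intro sum_colour[where y = "\<lambda>j. (y j)\<^sup>2"]) auto
      also have "\<dots> \<le> real (card ?C) * 1" using y2 by (intro mult_left_mono) auto
      finally show "(\<Sum>c\<in>?C. (y (c x))\<^sup>2) \<le> real (card ?C) / real m"
        using m by (simp add: field_simps)
    qed
    finally show ?thesis by (simp add: n_def field_simps)
  qed
  have dev: "(\<Sum>x\<in>N. y (c x)) = real (card {x\<in>N. c x = i}) - n / real m" for c
    using fN by (simp add: y_def sum_subtractf n_def Int_def)
  let ?B = "{c\<in>?C. real (card {x\<in>N. c x = i}) < n / (2 * real m)}"
  have fC: "finite ?C" using assms by (simp add: finite_PiE)
  have "real (card ?B) * (n / (2 * real m))\<^sup>2 = (\<Sum>c\<in>?B. (n / (2 * real m))\<^sup>2)"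
    by simp
  also have "\<dots> \<le> (\<Sum>c\<in>?B. (\<Sum>x\<in>N. y (c x))\<^sup>2)"
  proof (rule sum_mono)
    fix c assume "c \<in> ?B"
    then have "n / (2 * real m) \<le> - (\<Sum>x\<in>N. y (c x))"
      unfolding dev using m by (simp add: field_simps)
    then show "(n / (2 * real m))\<^sup>2 \<le> (\<Sum>x\<in>N. y (c x))\<^sup>2"
      using n m by (metis divide_nonneg_nonneg less_eq_real_def mult_nonneg_nonneg power2_minus power_mono zero_le_numeral)
  qed
  also have "\<dots> \<le> (\<Sum>c\<in>?C. (\<Sum>x\<in>N. y (c x))\<^sup>2)"
    using fC by (intro sum_mono2) auto
  also note var
  finally have "real (card ?B) \<le> real (card ?C) * (n / real m) / (n / (2 * real m))\<^sup>2"
    using n m by (subst pos_le_divide_eq) (auto simp: ac_simps)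
  also have "\<dots> = real (card ?C) * (4 * real m / n)"
    using n m by (simp add: power2_eq_square field_simps)
  finally show ?thesis by (simp add: n_def)
qed

text \<open>Averaging over all colourings. Colour class \<open>j\<close> has average weight equal to
  the total weight divided by \<open>m\<close>. A vertex is bad for some colour with probability at
  most \<open>4 * m ^ 2 / w v\<close>; weighting by degree cancels the denominator, so each vertex
  adds at most \<open>4 * m ^ 2\<close> to the average bad weight.\<close>

lemma ex_good_colouring:
  fixes V :: "'a set" and nb :: "'a \<Rightarrow> 'a set" and A B :: real and m :: nat
  defines "w \<equiv> \<lambda>v. real (card (nb v))"
  assumes "finite V" "\<And>v. v \<in> V \<Longrightarrow> nb v \<subseteq> V" "\<And>v. v \<in> V \<Longrightarrow> nb v \<noteq> {}" "j < m" "0 \<le> A"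
    and big: "A * (4 * (real m)\<^sup>2 * real (card V) + B) < (\<Sum>v\<in>V. w v) / real m"
  shows "\<exists>c\<in>V \<rightarrow>\<^sub>E {..<m}.
    A * ((\<Sum>v\<in>{v\<in>V. \<exists>i<m. real (card {x\<in>nb v. c x = i}) < w v / (2 * real m)}. w v) + B)
      < (\<Sum>v\<in>{v\<in>V. c v = j}. w v)"
proof (rule ccontr)
  let ?C = "V \<rightarrow>\<^sub>E {..<m}"
  let ?P = "\<lambda>c v i. real (card {x\<in>nb v. c x = i}) < w v / (2 * real m)"
  let ?bad = "\<lambda>c. \<Sum>v\<in>{v\<in>V. \<exists>i<m. ?P c v i}. w v"
  assume neg: "\<not> ?thesis"
  have m: "real m > 0" using assms by simp
  have fC: "finite ?C" using assms by (simp add: finite_PiE)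
  have C: "real (card ?C) > 0" using assms by (simp add: card_PiE)
  have w: "w v > 0" if "v \<in> V" for v
    using that assms by (metis card_gt_0_iff finite_subset of_nat_0_less_iff w_def)
  have bad: "?bad c \<le> (\<Sum>v\<in>V. \<Sum>i<m. of_bool (?P c v i) * w v)" for c
  proof -
    have "?bad c = (\<Sum>v\<in>V. of_bool (\<exists>i<m. ?P c v i) * w v)"
      using assms(2) by (simp add: Int_def conj_commute)
    also have "\<dots> \<le> (\<Sum>v\<in>V. \<Sum>i<m. of_bool (?P c v i) * w v)"
    proof (intro sum_mono)
      fix v assume v: "v \<in> V"
      show "of_bool (\<exists>i<m. ?P c v i) * w v \<le> (\<Sum>i<m. of_bool (?P c v i) * w v)"
      proof (cases "\<exists>i<m. ?P c v i")
        case True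
        then obtain i where i: "i < m" "?P c v i" by blast
        have "of_bool (?P c v i) * w v \<le> (\<Sum>i<m. of_bool (?P c v i) * w v)"
          using i w[OF v] by (intro member_le_sum) auto
        then show ?thesis using i True by simp
      next
        case False
        then show ?thesis using w[OF v] by (simp add: sum_nonneg)
      qed
    qed
    finally show ?thesis .
  qed
  have "real m * (\<Sum>c\<in>?C. \<Sum>v\<in>{v\<in>V. c v = j}. w v)
      = real m * (\<Sum>c\<in>?C. \<Sum>v\<in>V. of_bool (c v = j) * w v)"
    using assms(2) by (simp add: Int_def conj_commute)
  also have "\<dots> = (\<Sum>v\<in>V. w v * (real m * (\<Sum>c\<in>?C. of_bool (c v = j))))"
    by (subst sum.swap) (simp add: sum_distrib_left sum_distrib_right ac_simps)
  also have "\<dots> = (\<Sum>v\<in>V. w v * real (card ?C))"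
    using sum_colour[OF assms(2), of _ m "\<lambda>i. of_bool (i = j)"] assms(5)
    by (intro sum.cong refl) simp
  finally have top: "(\<Sum>c\<in>?C. \<Sum>v\<in>{v\<in>V. c v = j}. w v)
      = real (card ?C) * ((\<Sum>v\<in>V. w v) / real m)"
    using m by (simp add: field_simps sum_distrib_left sum_distrib_right)
  have "(\<Sum>c\<in>?C. ?bad c) \<le> (\<Sum>c\<in>?C. \<Sum>v\<in>V. \<Sum>i<m. of_bool (?P c v i) * w v)"
    by (intro sum_mono bad)
  also have "\<dots> = (\<Sum>v\<in>V. \<Sum>i<m. w v * (\<Sum>c\<in>?C. of_bool (?P c v i)))"
    by (subst sum.swap, intro sum.cong refl, subst sum.swap)
      (simp add: sum_distrib_left ac_simps)
  also have "\<dots> \<le> (\<Sum>v\<in>V. \<Sum>i<m. 4 * real m * real (card ?C))"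
  proof (intro sum_mono)
    fix v i assume v: "v \<in> V" and i: "i \<in> {..<m}"
    have "(\<Sum>c\<in>?C. of_bool (?P c v i)) = real (card {c\<in>?C. ?P c v i})"
      by (rule sum_of_bool_real[OF fC])
    also have "\<dots> \<le> real (card ?C) * (4 * real m / w v)"
      using colour_Chebyshev[OF assms(2), of "nb v" i m] v i assms(3,4) by (simp add: w_def)
    finally show "w v * (\<Sum>c\<in>?C. of_bool (?P c v i)) \<le> 4 * real m * real (card ?C)"
      using w[OF v] by (simp add: field_simps)
  qed
  also have "\<dots> = real (card ?C) * (4 * (real m)\<^sup>2 * real (card V))"
    by (simp add: power2_eq_square)
  finally have sbad: "(\<Sum>c\<in>?C. ?bad c) \<le> real (card ?C) * (4 * (real m)\<^sup>2 * real (card V))" .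
  have "(\<Sum>c\<in>?C. \<Sum>v\<in>{v\<in>V. c v = j}. w v) \<le> (\<Sum>c\<in>?C. A * (?bad c + B))"
    using neg by (intro sum_mono) (meson not_le)
  also have "\<dots> = A * ((\<Sum>c\<in>?C. ?bad c) + real (card ?C) * B)"
    by (simp add: sum.distrib flip: sum_distrib_left)
  also have "\<dots> \<le> A * (real (card ?C) * (4 * (real m)\<^sup>2 * real (card V)) + real (card ?C) * B)"
    using sbad assms by (intro mult_left_mono) auto
  also have "\<dots> = real (card ?C) * (A * (4 * (real m)\<^sup>2 * real (card V) + B))"
    by (simp add: algebra_simps)
  also have "\<dots> < real (card ?C) * ((\<Sum>v\<in>V. w v) / real m)"
    using C big by (rule mult_strict_left_mono[rotated])
  finally show False using top by simp
qed

subsection \<open>Layered graphs\<close>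

text \<open>A discrete intermediate value property. It serves to truncate the gains to a total of
  exactly \<open>2 * card S\<close>, which keeps the dense set small.\<close>

lemma ex_le_fun_sum_eq:
  fixes f :: "'a \<Rightarrow> nat"
  assumes "finite U" "t \<le> sum f U"
  shows "\<exists>g. (\<forall>v. g v \<le> f v) \<and> sum g U = t"
  using assms(2)
proof (induction t)
  case 0
  then show ?case by (intro exI[of _ "\<lambda>_. 0"]) simp
next
  case (Suc t)
  then obtain g where g: "\<And>v. g v \<le> f v" "sum g U = t" by auto
  have "\<exists>v\<in>U. g v < f v"
  proof (rule ccontr)
    assume "\<not> ?thesis"
    then have "sum f U \<le> sum g U" by (intro sum_mono) (meson not_le)
    with Suc.prems g(2) show False by simp
  qed
  then obtain v where v: "v \<in> U" "g v < f v" by blast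
  have "sum (g(v := Suc (g v))) U = Suc t"
    using v g assms(1) by (simp add: sum.remove[of U v])
  moreover have "(g(v := Suc (g v))) u \<le> f u" for u using g v by simp
  ultimately show ?case by blast
qed

text \<open>\<open>X v\<close> and \<open>Y v\<close> are disjoint parts of the neighbourhood of
  \<open>v\<close> one layer down. Fixing them in advance makes the condition on \<open>v\<close> a
  conjunction of two increasing events, as Harris' inequality requires, and guarantees two distinct
  children.\<close>

locale layered =
  fixes U :: "'a set" and l :: "'a \<Rightarrow> nat" and X Y :: "'a \<Rightarrow> 'a set"
  assumes finite_U: "finite U"
    and X_sub: "v \<in> U \<Longrightarrow> X v \<subseteq> U" and Y_sub: "v \<in> U \<Longrightarrow> Y v \<subseteq> U"
    and X_Y_disjoint: "v \<in> U \<Longrightarrow> X v \<inter> Y v = {}"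
    and level: "v \<in> U \<Longrightarrow> x \<in> X v \<union> Y v \<Longrightarrow> l v = Suc (l x)"
begin

definition N :: "'a \<Rightarrow> 'a set" where "N v = X v \<union> Y v"

definition base :: "'a set" where "base = {v\<in>U. l v = 0}"

inductive_set good :: "'a set \<Rightarrow> 'a set" for S :: "'a set" where
  good_base: "v \<in> S \<Longrightarrow> v \<in> good S"
| good_step: "v \<in> U \<Longrightarrow> a \<in> X v \<Longrightarrow> b \<in> Y v \<Longrightarrow> a \<in> good S \<Longrightarrow> b \<in> good S \<Longrightarrow> v \<in> good S"

text \<open>Two downward edges are the normal share of a vertex; the gain is the surplus. The
  subtraction is truncated, so fewer than two good neighbours give gain 0.\<close>

definition gain :: "'a set \<Rightarrow> 'a \<Rightarrow> nat" where
  "gain S v = card (N v \<inter> good S) - 2"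

lemma N_sub: "v \<in> U \<Longrightarrow> N v \<subseteq> U"
  using X_sub Y_sub by (auto simp: N_def)

lemma finite_N: "v \<in> U \<Longrightarrow> finite (N v)"
  using N_sub finite_subset[OF _ finite_U] by blast

lemma N_level: "v \<in> U \<Longrightarrow> x \<in> N v \<Longrightarrow> l v = Suc (l x)"
  using level by (auto simp: N_def)

lemma finite_base: "finite base"
  using finite_U by (simp add: base_def)

lemma good_mono:
  assumes "S \<subseteq> T"
  shows "good S \<subseteq> good T"
proof
  fix v assume "v \<in> good S"
  then show "v \<in> good T"
  proof (induction rule: good.induct)
    case (good_base v)
    then show ?case using assms by (blast intro: good.good_base)
  next
    case (good_step v a b)
    then show ?case by (blast intro: good.good_step)
  qed
qed

text \<open>The derivation of goodness unfolds into a binary tree. Overlaps between the trees of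
  \<open>a\<close> and \<open>b\<close> only lower the size, and the edge counts only rise when sets
  are merged.\<close>

lemma good_tree:
  assumes "v \<in> good S" "S \<subseteq> base"
  shows "\<exists>T. T \<subseteq> U \<and> v \<in> T \<and> card T < 2 ^ Suc (l v) \<and> (\<forall>u\<in>T. u \<in> S \<or> 2 \<le> card (N u \<inter> T))"
  using assms(1)
proof (induction rule: good.induct)
  case (good_base v)
  then show ?case using assms(2) by (intro exI[of _ "{v}"]) (auto simp: base_def)
next
  case (good_step v a b)
  obtain Ta where Ta: "Ta \<subseteq> U" "a \<in> Ta" "card Ta < 2 ^ Suc (l a)"
    "\<forall>u\<in>Ta. u \<in> S \<or> 2 \<le> card (N u \<inter> Ta)" using good_step by blast
  obtain Tb where Tb: "Tb \<subseteq> U" "b \<in> Tb" "card Tb < 2 ^ Suc (l b)"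
    "\<forall>u\<in>Tb. u \<in> S \<or> 2 \<le> card (N u \<inter> Tb)" using good_step by blast
  let ?T = "insert v (Ta \<union> Tb)"
  have fin: "finite ?T" using Ta Tb finite_U good_step by (meson finite_UnI finite_insert finite_subset)
  have l: "l v = Suc (l a)" "l v = Suc (l b)" using level good_step by auto
  have "card ?T \<le> Suc (card Ta + card Tb)"
    using card_Un_le[of Ta Tb] fin by (simp add: card_insert_if)
  also have "\<dots> < 2 ^ Suc (l v)" using Ta Tb l by simp
  finally have "card ?T < 2 ^ Suc (l v)" .
  moreover have "u \<in> S \<or> 2 \<le> card (N u \<inter> ?T)" if "u \<in> ?T" for u
  proof -
    have up: "2 \<le> card (N u \<inter> ?T)" if "2 \<le> card (N u \<inter> Z)" "Z \<subseteq> ?T" for Z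
      using that fin by (meson card_mono finite_Int Int_mono order.refl order.trans)
    have "2 \<le> card (N v \<inter> ?T)"
    proof -
      have "a \<noteq> b" using X_Y_disjoint good_step by blast
      moreover have "{a, b} \<subseteq> N v \<inter> ?T" using good_step Ta Tb by (auto simp: N_def)
      ultimately show ?thesis using card_mono[of "N v \<inter> ?T" "{a, b}"] fin by simp
    qed
    then show ?thesis using that Ta(4) Tb(4) up by blast
  qed
  ultimately show ?case using Ta Tb good_step by (intro exI[of _ ?T]) auto
qed

text \<open>\<open>W\<close> consists of \<open>S\<close>, the vertices \<open>v\<close> with
  positive truncated gain \<open>g v\<close>, and the trees below \<open>g v + 2\<close> good
  neighbours of each such \<open>v\<close>; \<open>v\<close> itself need not be good. Every vertex
  of \<open>W - S\<close> has at least \<open>g v + 2\<close> edges downwards, and the total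
  \<open>2 * card S\<close> of \<open>g\<close> makes up for the vertices of \<open>S\<close>, which
  have none.\<close>

lemma dense_of_gain:
  assumes "S \<subseteq> base" "S \<noteq> {}" "\<And>v. v \<in> U \<Longrightarrow> l v \<le> k"
    and gain: "2 * card S \<le> (\<Sum>v\<in>U. gain S v)"
  shows "\<exists>W\<subseteq>U. W \<noteq> {} \<and> card W \<le> card S * (1 + 8 * 2 ^ k) \<and> 2 * card W \<le> (\<Sum>v\<in>W. card (N v \<inter> W))"
proof -
  obtain g where g: "\<And>v. g v \<le> gain S v" "sum g U = 2 * card S"
    using ex_le_fun_sum_eq[OF finite_U gain] by blast
  define P where "P = {v\<in>U. 0 < g v}"
  have "\<exists>Z. Z \<subseteq> N v \<inter> good S \<and> card Z = g v + 2" if "v \<in> P" for v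
  proof -
    have "g v + 2 \<le> card (N v \<inter> good S)"
      using that g(1)[of v] by (auto simp: P_def gain_def)
    then show ?thesis by (metis obtain_subset_with_card_n)
  qed
  then obtain Z where Z: "\<And>v. v \<in> P \<Longrightarrow> Z v \<subseteq> N v \<inter> good S" "\<And>v. v \<in> P \<Longrightarrow> card (Z v) = g v + 2"
    by metis
  obtain T where T: "\<And>v. v \<in> good S \<Longrightarrow> T v \<subseteq> U" "\<And>v. v \<in> good S \<Longrightarrow> v \<in> T v"
    "\<And>v. v \<in> good S \<Longrightarrow> card (T v) < 2 ^ Suc (l v)"
    "\<And>v u. v \<in> good S \<Longrightarrow> u \<in> T v \<Longrightarrow> u \<in> S \<or> 2 \<le> card (N u \<inter> T v)"
    using good_tree[OF _ assms(1)] by metis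
  define W where "W = S \<union> (\<Union>v\<in>P. insert v (\<Union>u\<in>Z v. T u))"
  have PU: "P \<subseteq> U" by (auto simp: P_def)
  have finP: "finite P" using PU finite_U finite_subset by auto
  have SU: "S \<subseteq> U" using assms(1) by (auto simp: base_def)
  have WU: "W \<subseteq> U"
    using SU PU T(1) Z(1) unfolding W_def by blast
  have finW: "finite W" using WU finite_U finite_subset by auto
  have finS: "finite S" using SU finite_U finite_subset by auto
  have block: "card (insert v (\<Union>u\<in>Z v. T u)) \<le> g v * (4 * 2 ^ k)" if v: "v \<in> P" for v
  proof -
    have fz: "finite (Z v)" using Z(2)[OF v] by (metis card.infinite add_is_0 zero_neq_numeral)
    have "card (T u) \<le> 2 ^ k" if "u \<in> Z v" for u
    proof -
      \<comment> \<open>The trees are rooted one layer below \<open>v\<close>, which saves a factor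
        2 in their size.\<close>
      have "l v = Suc (l u)" using that Z(1)[OF v] v PU N_level by blast
      then have "Suc (l u) \<le> k" using assms(3)[of v] v PU by auto
      then have "(2::nat) ^ Suc (l u) \<le> 2 ^ k" by (intro power_increasing) auto
      then show ?thesis using T(3)[of u] that Z(1)[OF v] by fastforce
    qed
    then have "(\<Sum>u\<in>Z v. card (T u)) \<le> (g v + 2) * 2 ^ k"
      using sum_bounded_above[of "Z v" "\<lambda>u. card (T u)" "2 ^ k"] Z(2)[OF v] by simp
    then have "card (\<Union>u\<in>Z v. T u) \<le> (g v + 2) * 2 ^ k"
      using card_UN_le[OF fz, of T] by linarith
    then have "card (insert v (\<Union>u\<in>Z v. T u)) \<le> 1 + (g v + 2) * 2 ^ k"
      by (cases "finite (\<Union>u\<in>Z v. T u)") (auto simp: card_insert_if simp del: finite_UN)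
    \<comment> \<open>Because \<open>g v \<ge> 1\<close>, the additive terms are absorbed into
      multiples of \<open>g v\<close>; the total is then governed by the sum of
      \<open>g\<close>.\<close>
    also have "\<dots> \<le> g v * (4 * 2 ^ k)"
    proof -
      obtain h where h: "g v = Suc h" using v by (auto simp: P_def gr0_conv_Suc)
      have "(1::nat) \<le> 2 ^ k" by simp
      then have "1 \<le> 2 ^ k + h * (3 * 2 ^ k)" by (rule trans_le_add1)
      then show ?thesis unfolding h by (simp add: algebra_simps)
    qed
    finally show ?thesis .
  qed
  have gP: "sum g P = 2 * card S"
    unfolding g(2)[symmetric] using finite_U by (intro sum.mono_neutral_left) (auto simp: P_def)
  have "card W \<le> card S + (\<Sum>v\<in>P. card (insert v (\<Union>u\<in>Z v. T u)))"
    unfolding W_def by (rule order.trans[OF card_Un_le add_left_mono[OF card_UN_le[OF finP]]])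
  also have "\<dots> \<le> card S + (\<Sum>v\<in>P. g v * (4 * 2 ^ k))"
    by (intro add_left_mono sum_mono block)
  also have "\<dots> = card S * (1 + 8 * 2 ^ k)"
    unfolding sum_distrib_right[symmetric] gP by (simp add: algebra_simps)
  finally have card_W: "card W \<le> card S * (1 + 8 * 2 ^ k)" .
  \<comment> \<open>A vertex of \<open>P\<close> is joined to all of \<open>Z v\<close>; any other
    vertex outside \<open>S\<close> lies in one of the trees and has \<open>g v = 0\<close>.\<close>
  have out: "g v + 2 \<le> card (N v \<inter> W)" if v: "v \<in> W - S" for v
  proof (cases "v \<in> P")
    case True
    have "Z v \<subseteq> N v \<inter> W"
    proof
      fix u assume u: "u \<in> Z v"
      then have "u \<in> N v" "u \<in> T u" using Z(1)[OF True] T(2) by blast+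
      then show "u \<in> N v \<inter> W" using True u unfolding W_def by blast
    qed
    then have "card (Z v) \<le> card (N v \<inter> W)" using finW by (intro card_mono) auto
    then show ?thesis using Z(2)[OF True] by simp
  next
    case False
    then have "g v = 0" using v WU by (auto simp: P_def)
    moreover obtain u q where q: "q \<in> P" "u \<in> Z q" "v \<in> T u" using False v by (auto simp: W_def)
    moreover have "T u \<subseteq> W" using q by (auto simp: W_def)
    moreover have "2 \<le> card (N v \<inter> T u)" using q T(4)[of u v] Z(1)[of q] v by blast
    moreover have "card (N v \<inter> T u) \<le> card (N v \<inter> W)"
      using \<open>T u \<subseteq> W\<close> finW by (intro card_mono) auto
    ultimately show ?thesis by simp
  qed
  \<comment> \<open>A positive gain needs neighbours below, so such a vertex is not in layer
    0.\<close>
  have PWS: "P \<subseteq> W - S"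
  proof
    fix v assume v: "v \<in> P"
    then have "0 < gain S v" using g(1)[of v] by (auto simp: P_def)
    then have "N v \<noteq> {}" by (auto simp: gain_def)
    then have "l v \<noteq> 0" using v PU N_level by fastforce
    then show "v \<in> W - S" using v assms(1) by (auto simp: base_def W_def)
  qed
  have "2 * card S = sum g (W - S)"
    unfolding gP[symmetric] using PWS WU finW by (intro sum.mono_neutral_left) (auto simp: P_def)
  moreover have "card W = card S + card (W - S)"
    using finS finW by (metis W_def Un_upper1 card_Diff_subset card_mono le_add_diff_inverse)
  ultimately have "2 * card W = (\<Sum>v\<in>W - S. g v + 2)"
    unfolding sum.distrib sum_constant of_nat_id by linarith
  also have "\<dots> \<le> (\<Sum>v\<in>W - S. card (N v \<inter> W))" by (intro sum_mono out)
  also have "\<dots> \<le> (\<Sum>v\<in>W. card (N v \<inter> W))" using finW by (intro sum_mono2) auto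
  finally have "2 * card W \<le> (\<Sum>v\<in>W. card (N v \<inter> W))" .
  moreover have "W \<noteq> {}" using assms(2) by (simp add: W_def)
  ultimately show ?thesis using WU card_W by blast
qed

section \<open>Growth of the probability of being good\<close>

definition good_pr :: "real \<Rightarrow> 'a \<Rightarrow> real" where
  "good_pr p v = biased_ex p base (\<lambda>S. of_bool (v \<in> good S))"

definition ex_gain :: "real \<Rightarrow> 'a \<Rightarrow> real" where
  "ex_gain p v = biased_ex p base (\<lambda>S. real (gain S v))"

lemma good_pr_le_1: "0 \<le> p \<Longrightarrow> p \<le> 1 \<Longrightarrow> good_pr p v \<le> 1"
  using biased_ex_mono[of p base "\<lambda>S. of_bool (v \<in> good S)" "\<lambda>_. 1"]
  by (simp add: good_pr_def biased_ex_const finite_base)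

lemma ex_gain_nonneg: "0 \<le> p \<Longrightarrow> p \<le> 1 \<Longrightarrow> 0 \<le> ex_gain p v"
  using biased_ex_mono[of p base "\<lambda>_. 0" "\<lambda>S. real (gain S v)"]
  by (simp add: ex_gain_def biased_ex_const finite_base)

lemma good_pr_base:
  assumes "0 \<le> p" "p \<le> 1" "v \<in> base"
  shows "p \<le> good_pr p v"
proof -
  have "p = biased_ex p base (\<lambda>S. of_bool (v \<in> S))"
    using assms finite_base by (simp add: biased_ex_mem)
  also have "\<dots> \<le> good_pr p v"
    unfolding good_pr_def using assms by (intro biased_ex_mono) (auto intro: good_base)
  finally show ?thesis .
qed

text \<open>If the good vertices of \<open>Z\<close> cluster too much to meet \<open>Z\<close> with the expected probability,
  the excess is accounted for by the gain.\<close>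

lemma hit_pr:
  assumes "0 \<le> p" "p \<le> 1" "v \<in> U" "Z \<subseteq> N v"
  shows "((\<Sum>x\<in>Z. good_pr p x) - ex_gain p v) / 2 \<le> biased_ex p base (\<lambda>S. of_bool (Z \<inter> good S \<noteq> {}))"
proof -
  have fZ: "finite Z" using assms finite_N finite_subset by metis
  have "(\<Sum>x\<in>Z. good_pr p x) = biased_ex p base (\<lambda>S. \<Sum>x\<in>Z. of_bool (x \<in> good S))"
    unfolding good_pr_def biased_ex_sum ..
  \<comment> \<open>If \<open>Z\<close> is missed, the left side is 0; if it is hit, at most two of
    its good vertices are not counted by the gain at \<open>v\<close>.\<close>
  also have "\<dots> \<le> biased_ex p base (\<lambda>S. real (gain S v) + 2 * of_bool (Z \<inter> good S \<noteq> {}))"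
  proof (intro biased_ex_mono assms(1,2))
    fix S
    have "card (Z \<inter> good S) \<le> card (N v \<inter> good S)"
      using assms finite_N by (intro card_mono) auto
    then show "(\<Sum>x\<in>Z. of_bool (x \<in> good S)) \<le> real (gain S v) + 2 * of_bool (Z \<inter> good S \<noteq> {})"
      using fZ by (cases "Z \<inter> good S = {}") (auto simp: gain_def)
  qed
  also have "\<dots> = ex_gain p v + 2 * biased_ex p base (\<lambda>S. of_bool (Z \<inter> good S \<noteq> {}))"
    unfolding biased_ex_add biased_ex_cmult ex_gain_def ..
  finally show ?thesis by simp
qed

text \<open>Hitting \<open>X v\<close> and hitting \<open>Y v\<close> are both increasing in the
  random set, so Harris' inequality bounds from below the probability that both occur, which makes
  \<open>v\<close> good.\<close>

lemma good_pr_step: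
  assumes "0 \<le> p" "p \<le> 1" "v \<in> U"
  shows "biased_ex p base (\<lambda>S. of_bool (X v \<inter> good S \<noteq> {}))
    * biased_ex p base (\<lambda>S. of_bool (Y v \<inter> good S \<noteq> {})) \<le> good_pr p v"
proof -
  have "biased_ex p base (\<lambda>S. of_bool (X v \<inter> good S \<noteq> {}))
    * biased_ex p base (\<lambda>S. of_bool (Y v \<inter> good S \<noteq> {}))
    \<le> biased_ex p base (\<lambda>S. of_bool (X v \<inter> good S \<noteq> {}) * of_bool (Y v \<inter> good S \<noteq> {}))"
  proof (intro biased_ex_Harris finite_base assms(1,2))
    fix S T :: "'a set" and Z :: "'a set" assume "S \<subseteq> T"
    then have "good S \<subseteq> good T" by (rule good_mono)
    then show "(of_bool (X v \<inter> good S \<noteq> {}) :: real) \<le> of_bool (X v \<inter> good T \<noteq> {})"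
      "(of_bool (Y v \<inter> good S \<noteq> {}) :: real) \<le> of_bool (Y v \<inter> good T \<noteq> {})"
      by auto
  qed
  also have "\<dots> \<le> good_pr p v"
    unfolding good_pr_def
  proof (intro biased_ex_mono assms(1,2))
    fix S
    show "(of_bool (X v \<inter> good S \<noteq> {}) * of_bool (Y v \<inter> good S \<noteq> {}) :: real) \<le> of_bool (v \<in> good S)"
      using assms(3) by (auto intro: good_step)
  qed
  finally show ?thesis .
qed

text \<open>Induction on the layer. If \<open>q\<close> bounds the probability in layer
  \<open>i\<close> from below, a typical vertex of layer \<open>i + 1\<close> hits each part with
  probability at least \<open>\<eta> * q\<close>, hence is good with probability at least
  \<open>(\<eta> * q) ^ 2\<close>. Multiplied by \<open>\<eta> ^ 2\<close>, this recursion is pure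
  squaring, starting from \<open>K\<close>. The weight of the exceptional set \<open>B\<close> grows
  by a factor \<open>17 * \<kappa>\<close> per layer.\<close>

lemma good_pr_growth:
  fixes w :: "'a \<Rightarrow> real" and \<delta> \<kappa> K p :: real and D :: "'a set"
  defines "\<eta> \<equiv> \<delta> / (32 * \<kappa>)"
  defines "T \<equiv> (\<Sum>v\<in>D \<inter> U. w v) + 16 * \<kappa> * (\<Sum>v\<in>U. ex_gain p v) / p"
  assumes "0 < \<delta>" "1 \<le> \<kappa>" "1 \<le> K" and p: "p = K / \<eta>\<^sup>2" "p \<le> 1"
    and w: "\<And>v. v \<in> U \<Longrightarrow> \<delta> \<le> w v"
    and indeg: "\<And>x. x \<in> U \<Longrightarrow> real (card {v\<in>U. x \<in> N v}) \<le> w x"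
    and large: "\<And>v. v \<in> U \<Longrightarrow> v \<notin> D \<Longrightarrow> 0 < l v \<Longrightarrow>
      3 * w v / (16 * \<kappa>) \<le> real (card (X v)) \<and> 3 * w v / (16 * \<kappa>) \<le> real (card (Y v))"
  shows "\<exists>B\<subseteq>U. (\<Sum>v\<in>B. w v) \<le> (17 * \<kappa>) ^ i * T \<and>
    (\<forall>v\<in>U. l v = i \<longrightarrow> v \<notin> B \<longrightarrow> K ^ (2 ^ i) / \<eta>\<^sup>2 \<le> good_pr p v)"
proof -
  have \<eta>: "\<eta> > 0" using assms by (simp add: \<eta>_def)
  have p0: "p > 0" using assms \<eta> by simp
  have w0: "w v > 0" if "v \<in> U" for v using w[OF that] assms by simp
  have T0: "T \<ge> 0"
    unfolding T_def using assms p0 w0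
    by (intro add_nonneg_nonneg divide_nonneg_pos mult_nonneg_nonneg sum_nonneg ex_gain_nonneg)
      (auto intro: less_imp_le)
  show ?thesis
  proof (induction i)
    case 0
    have "\<forall>v\<in>U. l v = 0 \<longrightarrow> p \<le> good_pr p v"
      using good_pr_base p0 p(2) by (simp add: base_def)
    then show ?case using T0 p by (intro exI[of _ "{}"]) simp
  next
    case (Suc i)
    then obtain B where B: "B \<subseteq> U" "(\<Sum>v\<in>B. w v) \<le> (17 * \<kappa>) ^ i * T"
      "\<And>v. v \<in> U \<Longrightarrow> l v = i \<Longrightarrow> v \<notin> B \<Longrightarrow> K ^ (2 ^ i) / \<eta>\<^sup>2 \<le> good_pr p v" by blast
    define q where "q = K ^ (2 ^ i) / \<eta>\<^sup>2"
    have finB: "finite B" using B finite_U finite_subset by auto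
    have "K ^ 1 \<le> K ^ (2 ^ i)" using assms by (intro power_increasing) auto
    then have pq: "p \<le> q" unfolding p q_def using \<eta> by (intro divide_right_mono) auto
    then have q0: "q > 0" using p0 by simp
    \<comment> \<open>Besides \<open>D\<close>, the new exceptional vertices are those with many
      neighbours in the previous exceptional set (\<open>B1\<close>) and those with large expected
      gain (\<open>B2\<close>).\<close>
    define B1 where "B1 = {v\<in>U. w v / (16 * \<kappa>) < real (card (N v \<inter> B))}"
    define B2 where "B2 = {v\<in>U. w v * q / (16 * \<kappa>) < ex_gain p v}"
    define B' where "B' = (D \<inter> U) \<union> B1 \<union> B2"
    have fin: "finite (D \<inter> U)" "finite B1" "finite B2"
      using finite_U by (auto simp: B1_def B2_def)
    \<comment> \<open>Double counting of the pairs \<open>v\<close>, \<open>x\<close> with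
      \<open>x\<close> in \<open>N v\<close> and in \<open>B\<close>: each such \<open>x\<close>
      lies in at most \<open>w x\<close> sets \<open>N v\<close>.\<close>
    have "(\<Sum>v\<in>B1. w v) \<le> (\<Sum>v\<in>B1. 16 * \<kappa> * real (card (N v \<inter> B)))"
      using assms(4) by (intro sum_mono) (simp add: B1_def field_simps)
    also have "\<dots> \<le> (\<Sum>v\<in>U. 16 * \<kappa> * real (card (N v \<inter> B)))"
      using finite_U assms(4) by (intro sum_mono2) (auto simp: B1_def)
    also have "\<dots> = 16 * \<kappa> * (\<Sum>v\<in>U. \<Sum>x\<in>B. of_bool (x \<in> N v))"
      using finB by (simp add: sum_distrib_left Int_commute)
    also have "(\<Sum>v\<in>U. \<Sum>x\<in>B. of_bool (x \<in> N v) :: real) = (\<Sum>x\<in>B. \<Sum>v\<in>U. of_bool (x \<in> N v))"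
      by (rule sum.swap)
    also have "\<dots> = (\<Sum>x\<in>B. real (card {v\<in>U. x \<in> N v}))"
      by (intro sum.cong refl sum_of_bool_real finite_U)
    also have "16 * \<kappa> * \<dots> \<le> 16 * \<kappa> * (\<Sum>x\<in>B. w x)"
      using B(1) assms(4) by (intro mult_left_mono sum_mono indeg) auto
    also have "\<dots> \<le> 16 * \<kappa> * ((17 * \<kappa>) ^ i * T)"
      using B(2) assms(4) by (intro mult_left_mono) auto
    finally have sB1: "(\<Sum>v\<in>B1. w v) \<le> 16 * \<kappa> * ((17 * \<kappa>) ^ i * T)" .
    \<comment> \<open>A Markov-type estimate; replacing \<open>q\<close> by the smaller
      \<open>p\<close> gives one bound for all layers.\<close>
    have "(\<Sum>v\<in>B2. w v) \<le> (\<Sum>v\<in>B2. 16 * \<kappa> * ex_gain p v / p)"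
    proof (rule sum_mono)
      fix v assume v: "v \<in> B2"
      have "w v * p \<le> w v * q"
        using pq w0[of v] v by (intro mult_left_mono) (auto simp: B2_def)
      also have "\<dots> \<le> 16 * \<kappa> * ex_gain p v"
        using v assms(4) by (simp add: B2_def field_simps)
      finally show "w v \<le> 16 * \<kappa> * ex_gain p v / p" using p0 by (simp add: field_simps)
    qed
    also have "\<dots> \<le> (\<Sum>v\<in>U. 16 * \<kappa> * ex_gain p v / p)"
      using finite_U assms(4) p0 p(2) by (intro sum_mono2) (auto simp: B2_def ex_gain_nonneg)
    also have "\<dots> = 16 * \<kappa> * (\<Sum>v\<in>U. ex_gain p v) / p"
      by (simp add: sum_distrib_left sum_divide_distrib)
    finally have sB2: "(\<Sum>v\<in>B2. w v) \<le> 16 * \<kappa> * (\<Sum>v\<in>U. ex_gain p v) / p" .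
    have "(\<Sum>v\<in>B'. w v) \<le> (\<Sum>v\<in>D \<inter> U. w v) + (\<Sum>v\<in>B1. w v) + (\<Sum>v\<in>B2. w v)"
    proof -
      have nn: "0 \<le> (\<Sum>v\<in>Z. w v)" if "Z \<subseteq> U" for Z
        using that w0 by (intro sum_nonneg) (auto intro: less_imp_le)
      have "0 \<le> sum w ((D \<inter> U) \<inter> B1)" by (rule nn) blast
      moreover have "0 \<le> sum w (((D \<inter> U) \<union> B1) \<inter> B2)" by (rule nn) (auto simp: B1_def)
      ultimately show ?thesis
        using fin sum_Un[of "D \<inter> U" B1 w] sum_Un[of "(D \<inter> U) \<union> B1" B2 w] by (simp add: B'_def)
    qed
    also have "\<dots> \<le> T + 16 * \<kappa> * ((17 * \<kappa>) ^ i * T)"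
      using sB1 sB2 by (simp add: T_def)
    \<comment> \<open>The extra \<open>T\<close> is absorbed by raising the factor from
      \<open>16 * \<kappa>\<close> to \<open>17 * \<kappa>\<close>.\<close>
    also have "\<dots> \<le> (17 * \<kappa>) ^ Suc i * T"
    proof -
      have "1 * 1 \<le> \<kappa> * (17 * \<kappa>) ^ i" using assms(4) by (intro mult_mono one_le_power) auto
      then have "1 * T \<le> (\<kappa> * (17 * \<kappa>) ^ i) * T" using T0 by (intro mult_right_mono) auto
      then show ?thesis by (simp add: algebra_simps)
    qed
    finally have sB': "(\<Sum>v\<in>B'. w v) \<le> (17 * \<kappa>) ^ Suc i * T" .
    have "K ^ (2 ^ Suc i) / \<eta>\<^sup>2 \<le> good_pr p v" if v: "v \<in> U" "l v = Suc i" "v \<notin> B'" for v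
    proof -
      \<comment> \<open>In units of \<open>w v / (16 * \<kappa>)\<close>: of the 3 units of
        \<open>Z\<close> at most 1 lies in \<open>B\<close>, and the expected gain costs at most one
        more unit times \<open>q\<close>. Halving the remaining unit gives the 32 in
        \<open>\<eta>\<close>.\<close>
      have hit: "\<eta> * q \<le> biased_ex p base (\<lambda>S. of_bool (Z \<inter> good S \<noteq> {}))"
        if Z: "Z \<subseteq> N v" "3 * w v / (16 * \<kappa>) \<le> real (card Z)" for Z
      proof -
        have fN: "finite (N v)" and fZ: "finite Z" using finite_N v Z finite_subset by metis+
        have "card Z = card (Z - B) + card (Z \<inter> B)"
          using fZ by (metis card_Diff_subset_Int card_mono finite_Int inf_le1 le_add_diff_inverse2)
        moreover have "card (Z \<inter> B) \<le> card (N v \<inter> B)"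
          using Z fN by (intro card_mono) auto
        moreover have "real (card (N v \<inter> B)) \<le> w v / (16 * \<kappa>)"
          using v by (auto simp: B'_def B1_def)
        ultimately have "w v / (8 * \<kappa>) \<le> real (card (Z - B))"
          using Z(2) by (simp add: field_simps)
        then have "w v / (8 * \<kappa>) * q \<le> real (card (Z - B)) * q"
          using q0 by (intro mult_right_mono) auto
        also have "\<dots> = (\<Sum>x\<in>Z - B. q)" by simp
        also have "\<dots> \<le> (\<Sum>x\<in>Z - B. good_pr p x)"
        proof (rule sum_mono)
          fix x assume x: "x \<in> Z - B"
          then have "x \<in> U" "l x = i" using N_sub N_level v Z by fastforce+
          then show "q \<le> good_pr p x" using B(3) x by (simp add: q_def)
        qed
        also have "\<dots> \<le> (\<Sum>x\<in>Z. good_pr p x)"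
        proof (intro sum_mono2 fZ)
          show "0 \<le> good_pr p x" for x
            using biased_ex_mono[of p base "\<lambda>_. 0" "\<lambda>S. of_bool (x \<in> good S)"] p0 p(2)
            by (simp add: good_pr_def biased_ex_const finite_base)
        qed auto
        finally have 1: "w v / (8 * \<kappa>) * q \<le> (\<Sum>x\<in>Z. good_pr p x)" .
        have 2: "ex_gain p v \<le> w v * q / (16 * \<kappa>)" using v by (auto simp: B'_def B2_def)
        have "\<eta> * q = \<delta> * q / (32 * \<kappa>)" by (simp add: \<eta>_def)
        also have "\<dots> \<le> w v * q / (32 * \<kappa>)"
          using w[OF v(1)] q0 assms(4) by (intro divide_right_mono mult_right_mono) auto
        also have "\<dots> = (w v / (8 * \<kappa>) * q - w v * q / (16 * \<kappa>)) / 2"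
          using assms(4) by (simp add: field_simps)
        also have "\<dots> \<le> ((\<Sum>x\<in>Z. good_pr p x) - ex_gain p v) / 2"
          using 1 2 by (intro divide_right_mono diff_mono) auto
        also have "\<dots> \<le> biased_ex p base (\<lambda>S. of_bool (Z \<inter> good S \<noteq> {}))"
          using p0 p(2) v Z by (intro hit_pr) auto
        finally show ?thesis .
      qed
      have "v \<notin> D" using v by (auto simp: B'_def)
      then have XY: "\<eta> * q \<le> biased_ex p base (\<lambda>S. of_bool (X v \<inter> good S \<noteq> {}))"
        "\<eta> * q \<le> biased_ex p base (\<lambda>S. of_bool (Y v \<inter> good S \<noteq> {}))"
        using large[of v] v by (auto intro!: hit simp: N_def)
      have "K ^ (2 ^ Suc i) = K ^ (2 ^ i) * K ^ (2 ^ i)"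
        by (simp only: power_Suc mult_2 power_add)
      then have "K ^ (2 ^ Suc i) / \<eta>\<^sup>2 = (\<eta> * q) * (\<eta> * q)"
        using \<eta> by (simp add: q_def power2_eq_square field_simps)
      also have "\<dots> \<le> biased_ex p base (\<lambda>S. of_bool (X v \<inter> good S \<noteq> {}))
        * biased_ex p base (\<lambda>S. of_bool (Y v \<inter> good S \<noteq> {}))"
        using XY \<eta> q0 by (intro mult_mono) (auto intro: order.trans[OF _ XY(1)])
      also have "\<dots> \<le> good_pr p v"
        using p0 p(2) v by (intro good_pr_step) auto
      finally show ?thesis .
    qed
    then show ?case
      using sB' fin by (intro exI[of _ B']) (auto simp: B'_def B1_def B2_def)
  qed
qed

text \<open>First moment method with an exponential penalty, which yields large gain and small size
  for the same set \<open>S\<close>.\<close>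

lemma ex_gainful_base:
  fixes p :: real and M :: nat
  assumes "0 \<le> p" "p \<le> 1"
    and big: "3 * p * real (card U) < (\<Sum>v\<in>U. ex_gain p v)"
    and tail: "real (card U) * (1 + 2 * p) ^ card U \<le> p * 3 ^ M"
  shows "\<exists>S\<subseteq>base. S \<noteq> {} \<and> card S < M \<and> 2 * card S \<le> (\<Sum>v\<in>U. gain S v)"
proof -
  define n where "n = card U"
  \<comment> \<open>The total gain never exceeds \<open>n ^ 2\<close>, so \<open>f S > 0\<close>
    forces \<open>3 ^ card S < 3 ^ M\<close>. In expectation the second term costs at most
    \<open>2 * p * n\<close> and, by \<open>tail\<close>, the third at most \<open>p * n\<close>;
    this explains the 3 in \<open>big\<close>.\<close>
  define f where "f S = real (\<Sum>v\<in>U. gain S v) - 2 * real (card S) - (real n)\<^sup>2 / 3 ^ M * 3 ^ card S"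
    for S
  have bU: "card base \<le> n"
    using finite_U by (auto simp: base_def n_def intro: card_mono)
  have "biased_ex p base f = (\<Sum>v\<in>U. ex_gain p v) - 2 * (p * real (card base))
      - (real n)\<^sup>2 / 3 ^ M * (1 - p + p * 3) ^ card base"
    unfolding f_def biased_ex_diff biased_ex_cmult of_nat_sum biased_ex_sum ex_gain_def
    by (simp add: finite_base biased_ex_card biased_ex_power_card)
  also have "\<dots> \<ge> (\<Sum>v\<in>U. ex_gain p v) - 2 * (p * real n) - p * real n"
  proof -
    have "(1 - p + p * 3) ^ card base \<le> (1 + 2 * p) ^ n"
      using power_increasing[OF bU, of "1 + 2 * p"] assms(1) by (simp add: add.commute)
    then have "(real n)\<^sup>2 / 3 ^ M * (1 - p + p * 3) ^ card base \<le> (real n)\<^sup>2 / 3 ^ M * (1 + 2 * p) ^ n"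
      by (intro mult_left_mono) auto
    also have "\<dots> = real n * (real n * (1 + 2 * p) ^ n) / 3 ^ M"
      by (simp add: power2_eq_square)
    also have "\<dots> \<le> real n * (p * 3 ^ M) / 3 ^ M"
      using tail by (intro divide_right_mono mult_left_mono) (auto simp: n_def)
    also have "\<dots> = p * real n" by simp
    finally have 1: "(real n)\<^sup>2 / 3 ^ M * (1 - p + p * 3) ^ card base \<le> p * real n" .
    have "p * real (card base) \<le> p * real n" using bU assms(1) by (intro mult_left_mono) auto
    with 1 show ?thesis by simp
  qed
  finally have "biased_ex p base f > 0" using big by (simp add: n_def)
  moreover have "biased_ex p base f \<le> biased_ex p base (\<lambda>_. 0)" if "\<And>S. S \<subseteq> base \<Longrightarrow> f S \<le> 0"
    using assms(1,2) that by (rule biased_ex_mono)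
  ultimately obtain S where S: "S \<subseteq> base" "f S > 0"
    by (metis biased_ex_const finite_base not_le)
  have pos: "0 \<le> (real n)\<^sup>2 / 3 ^ M * 3 ^ card S" by simp
  have "gain S v \<le> n" if "v \<in> U" for v
  proof -
    have "card (N v \<inter> good S) \<le> card U" using N_sub[OF that] finite_U by (intro card_mono) auto
    then show ?thesis by (simp add: gain_def n_def)
  qed
  then have "(\<Sum>v\<in>U. gain S v) \<le> n * n"
    using sum_bounded_above[of U "gain S" n] by (simp add: n_def)
  then have "real (\<Sum>v\<in>U. gain S v) \<le> (real n)\<^sup>2"
    by (simp only: power2_eq_square flip: of_nat_mult)
  then have "(real n)\<^sup>2 / 3 ^ M * 3 ^ card S < (real n)\<^sup>2" using S(2) by (simp add: f_def)
  then have "(real n)\<^sup>2 * 3 ^ card S < (real n)\<^sup>2 * 3 ^ M" by (simp add: field_simps)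
  then have "(3::real) ^ card S < 3 ^ M" by (simp add: mult_less_cancel_left_pos zero_less_mult_iff mult_less_cancel_left)
  then have "card S < M" by simp
  moreover have "real (2 * card S) < real (\<Sum>v\<in>U. gain S v)"
    using S(2) pos unfolding f_def by linarith
  then have g: "2 * card S < (\<Sum>v\<in>U. gain S v)" unfolding of_nat_less_iff .
  \<comment> \<open>Without seeds no vertex is good, so the empty set has gain 0 and violates the
    strict inequality.\<close>
  moreover have "S \<noteq> {}"
  proof
    assume S: "S = {}"
    have "v \<notin> good {}" for v
    proof
      show "v \<in> good {} \<Longrightarrow> False" by (induction rule: good.induct) auto
    qed
    then have "good S = {}" using S by auto
    then have "(\<Sum>v\<in>U. gain S v) = 0" by (simp add: gain_def)
    then show False using g by simp
  qed
  ultimately show ?thesis using S by (intro exI[of _ S]) auto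
qed

text \<open>If the expected gain were small, the exceptional vertices would weigh less than the top
  layer. Some vertex there would then be good with probability at least
  \<open>K ^ (2 ^ k) / \<eta> ^ 2\<close>, which exceeds 1. So the expected gain is large, and a
  suitable base set \<open>S\<close> yields \<open>W\<close>.\<close>

lemma ex_dense:
  fixes w :: "'a \<Rightarrow> real" and \<delta> \<kappa> K p :: real and D :: "'a set"
  defines "\<eta> \<equiv> \<delta> / (32 * \<kappa>)"
  assumes "0 < \<delta>" "1 \<le> \<kappa>" "1 \<le> K" and p: "p = K / \<eta>\<^sup>2" "p \<le> 1"
    and w: "\<And>v. v \<in> U \<Longrightarrow> \<delta> \<le> w v"
    and indeg: "\<And>x. x \<in> U \<Longrightarrow> real (card {v\<in>U. x \<in> N v}) \<le> w x"
    and large: "\<And>v. v \<in> U \<Longrightarrow> v \<notin> D \<Longrightarrow> 0 < l v \<Longrightarrow>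
      3 * w v / (16 * \<kappa>) \<le> real (card (X v)) \<and> 3 * w v / (16 * \<kappa>) \<le> real (card (Y v))"
    and top: "(17 * \<kappa>) ^ k * ((\<Sum>v\<in>D \<inter> U. w v) + 48 * \<kappa> * real (card U)) < (\<Sum>v\<in>{v\<in>U. l v = k}. w v)"
    and k: "\<eta>\<^sup>2 < K ^ (2 ^ k)" "\<And>v. v \<in> U \<Longrightarrow> l v \<le> k"
    and tail: "real (card U) * (1 + 2 * p) ^ card U \<le> p * 3 ^ M"
  shows "\<exists>W\<subseteq>U. W \<noteq> {} \<and> card W \<le> M * (1 + 8 * 2 ^ k) \<and> 2 * card W \<le> (\<Sum>v\<in>W. card (N v \<inter> W))"
proof -
  have \<eta>: "\<eta> > 0" using assms by (simp add: \<eta>_def)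
  have p0: "p > 0" using assms \<eta> by simp
  have "3 * p * real (card U) < (\<Sum>v\<in>U. ex_gain p v)"
  proof (rule ccontr)
    assume "\<not> ?thesis"
    then have le: "16 * \<kappa> * (\<Sum>v\<in>U. ex_gain p v) / p \<le> 16 * \<kappa> * (3 * p * real (card U)) / p"
      using p0 assms(3) by (intro divide_right_mono mult_left_mono) auto
    obtain B where B: "B \<subseteq> U"
      "(\<Sum>v\<in>B. w v) \<le> (17 * \<kappa>) ^ k * ((\<Sum>v\<in>D \<inter> U. w v) + 16 * \<kappa> * (\<Sum>v\<in>U. ex_gain p v) / p)"
      "\<And>v. v \<in> U \<Longrightarrow> l v = k \<Longrightarrow> v \<notin> B \<Longrightarrow> K ^ (2 ^ k) / \<eta>\<^sup>2 \<le> good_pr p v"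
      using good_pr_growth[of \<delta> \<kappa> K p w D k] assms unfolding \<eta>_def by blast
    note B(2)
    also have "(17 * \<kappa>) ^ k * ((\<Sum>v\<in>D \<inter> U. w v) + 16 * \<kappa> * (\<Sum>v\<in>U. ex_gain p v) / p)
      \<le> (17 * \<kappa>) ^ k * ((\<Sum>v\<in>D \<inter> U. w v) + 48 * \<kappa> * real (card U))"
      using le p0 assms(3) by (intro mult_left_mono add_left_mono) auto
    also note top
    finally have lt: "sum w B < sum w {v\<in>U. l v = k}" .
    have "\<not> {v\<in>U. l v = k} \<subseteq> B"
    proof
      assume "{v\<in>U. l v = k} \<subseteq> B"
      then have "sum w {v\<in>U. l v = k} \<le> sum w B"
        using B(1) finite_U w assms(2) by (intro sum_mono2) (auto intro: finite_subset order.trans[OF less_imp_le])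
      then show False using lt by simp
    qed
    then obtain v where "v \<in> U" "l v = k" "v \<notin> B" by blast
    then have "K ^ (2 ^ k) / \<eta>\<^sup>2 \<le> 1"
      using B(3) good_pr_le_1[of p v] p0 p(2) by force
    then show False using k(1) \<eta> by (simp add: field_simps)
  qed
  then obtain S where S: "S \<subseteq> base" "S \<noteq> {}" "card S < M" "2 * card S \<le> (\<Sum>v\<in>U. gain S v)"
    using ex_gainful_base[of p M] p0 p(2) tail by auto
  obtain W where W: "W \<subseteq> U" "W \<noteq> {}" "card W \<le> card S * (1 + 8 * 2 ^ k)"
    "2 * card W \<le> (\<Sum>v\<in>W. card (N v \<inter> W))"
    using dense_of_gain[OF S(1,2) k(2) S(4)] by blast
  have "card S * (1 + 8 * 2 ^ k) \<le> M * (1 + 8 * 2 ^ k)" using S(3) by (intro mult_right_mono) auto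
  with W show ?thesis by (intro exI[of _ W]) auto
qed

end

subsection \<open>Dense subgraphs and subhypergraphs\<close>

text \<open>A random colouring with \<open>k + 1\<close> colours provides the layers, and only edges
  between consecutive colours are kept. \<open>D\<close> collects the vertices with too few
  neighbours in some colour; the chosen colouring makes their weight negligible against the top
  layer.\<close>

lemma dense_subgraph_of_min_degree:
  fixes V :: "'a set" and nb :: "'a \<Rightarrow> 'a set" and \<delta> K p :: real and k M :: nat
  defines "\<eta> \<equiv> \<delta> / (32 * (real k + 1))"
  assumes V: "finite V" "V \<noteq> {}" and nb: "\<And>v. v \<in> V \<Longrightarrow> nb v \<subseteq> V"
    and sym: "\<And>v x. v \<in> V \<Longrightarrow> x \<in> nb v \<Longrightarrow> v \<in> nb x"
    and deg: "\<And>v. v \<in> V \<Longrightarrow> \<delta> \<le> real (card (nb v))"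
    and \<delta>: "(17 * (real k + 1)) ^ (k + 3) \<le> \<delta>"
    and K: "1 \<le> K" "\<eta>\<^sup>2 < K ^ (2 ^ k)" and p: "p = K / \<eta>\<^sup>2" "p \<le> 1"
    and tail: "real (card V) * (1 + 2 * p) ^ card V \<le> p * 3 ^ M"
  shows "\<exists>W\<subseteq>V. W \<noteq> {} \<and> card W \<le> M * (1 + 8 * 2 ^ k) \<and>
    2 * card W \<le> card {{v, x} |v x. v \<in> W \<and> x \<in> W \<and> x \<in> nb v}"
proof -
  define m where "m = k + 1"
  define w where "w v = real (card (nb v))" for v
  define n where "n = real (card V)"
  have m1: "real m \<ge> 1" by (simp add: m_def)
  have n0: "n > 0" using V by (simp add: n_def card_gt_0_iff)
  have \<delta>m: "(17 * real m) ^ (k + 3) \<le> \<delta>" using \<delta> by (simp add: m_def add.commute)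
  have "(17 * real m) ^ 1 \<le> (17 * real m) ^ (k + 3)" using m1 by (intro power_increasing) auto
  then have \<delta>8: "8 * real m \<le> \<delta>" using \<delta>m m1 by simp
  then have \<delta>0: "\<delta> > 0" using m1 by linarith
  have nb_ne: "nb v \<noteq> {}" if "v \<in> V" for v using deg[OF that] \<delta>0 by auto
  have big: "(17 * real m) ^ k * (4 * (real m)\<^sup>2 * real (card V) + 48 * real m * n)
    < (\<Sum>v\<in>V. w v) / real m"
  proof -
    have "real m * n * 1 \<le> real m * n * real m" using m1 n0 by (intro mult_left_mono) auto
    then have "4 * (real m)\<^sup>2 * n + 48 * real m * n \<le> 52 * (real m)\<^sup>2 * n"
      by (simp add: power2_eq_square ac_simps)
    then have "real m * ((17 * real m) ^ k * (4 * (real m)\<^sup>2 * n + 48 * real m * n))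
      \<le> real m * ((17 * real m) ^ k * (52 * (real m)\<^sup>2 * n))"
      using m1 by (intro mult_left_mono) auto
    \<comment> \<open>The three extra powers of \<open>17 * m\<close> in the degree assumption pay
      for \<open>m ^ 2\<close> from Chebyshev's inequality, for the share \<open>1 / m\<close> of
      the top layer, and for the constant 52.\<close>
    also have "\<dots> = 52 * ((17 * real m) ^ k * (real m) ^ 3 * n)"
      by (simp add: power2_eq_square power3_eq_cube)
    also have "\<dots> < 4913 * ((17 * real m) ^ k * (real m) ^ 3 * n)"
      using m1 n0 by (intro mult_strict_right_mono) auto
    also have "\<dots> = (17 * real m) ^ (k + 3) * n"
      by (simp add: power_add power3_eq_cube)
    also have "\<dots> \<le> \<delta> * n" using \<delta>m n0 by (intro mult_right_mono) auto
    also have "\<dots> = (\<Sum>v\<in>V. \<delta>)" by (simp add: n_def)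
    also have "\<dots> \<le> (\<Sum>v\<in>V. w v)" unfolding w_def by (intro sum_mono deg)
    finally show ?thesis using m1 by (simp add: n_def field_simps)
  qed
  obtain c where c: "c \<in> V \<rightarrow>\<^sub>E {..<m}" and top: "(17 * real m) ^ k *
      ((\<Sum>v\<in>{v\<in>V. \<exists>i<m. real (card {x\<in>nb v. c x = i}) < w v / (2 * real m)}. w v) + 48 * real m * n)
    < (\<Sum>v\<in>{v\<in>V. c v = k}. w v)"
    using ex_good_colouring[OF V(1), of nb k m "(17 * real m) ^ k" "48 * real m * n"] nb nb_ne big m1
    unfolding w_def by (auto simp: m_def)
  define D where "D = {v\<in>V. \<exists>i<m. real (card {x\<in>nb v. c x = i}) < w v / (2 * real m)}"
  define L where "L v = {x\<in>nb v. c v = Suc (c x)}" for v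
  have "\<exists>Z. Z \<subseteq> L v \<and> card Z = card (L v) div 2" for v
    by (metis div_le_dividend obtain_subset_with_card_n)
  then obtain X where X: "\<And>v. X v \<subseteq> L v" "\<And>v. card (X v) = card (L v) div 2" by metis
  define Y where "Y v = L v - X v" for v
  have L_sub: "L v \<subseteq> V" if "v \<in> V" for v using nb[OF that] by (auto simp: L_def)
  interpret layered V c X Y
  proof
    fix v x assume v: "v \<in> V"
    show "X v \<subseteq> V" "Y v \<subseteq> V" using X(1)[of v] L_sub[OF v] by (auto simp: Y_def)
    show "X v \<inter> Y v = {}" by (auto simp: Y_def)
    show "c v = Suc (c x)" if "x \<in> X v \<union> Y v" using that X(1)[of v] by (auto simp: Y_def L_def)
  qed (rule V(1))
  have NL: "N v = L v" for v using X(1)[of v] by (auto simp: N_def Y_def)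
  have "\<exists>W\<subseteq>V. W \<noteq> {} \<and> card W \<le> M * (1 + 8 * 2 ^ k) \<and> 2 * card W \<le> (\<Sum>v\<in>W. card (N v \<inter> W))"
  proof (rule ex_dense[where \<delta> = \<delta> and \<kappa> = "real m" and K = K and p = p and w = w and D = D and k = k])
    show "\<delta> \<le> w v" if "v \<in> V" for v using deg[OF that] by (simp add: w_def)
    show "real (card {v \<in> V. x \<in> N v}) \<le> w x" if "x \<in> V" for x
    proof -
      have "{v\<in>V. x \<in> N v} \<subseteq> nb x" using sym by (auto simp: NL L_def)
      moreover have "finite (nb x)" using nb[OF that] V(1) finite_subset by auto
      ultimately show ?thesis unfolding w_def by (simp add: card_mono)
    qed
    show "3 * w v / (16 * real m) \<le> real (card (X v)) \<and> 3 * w v / (16 * real m) \<le> real (card (Y v))"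
      if v: "v \<in> V" "v \<notin> D" "0 < c v" for v
    proof -
      have "c v < m" using c v(1) by auto
      then have "c v - 1 < m" by simp
      moreover have "L v = {x\<in>nb v. c x = c v - 1}" using v(3) by (auto simp: L_def)
      moreover have "\<forall>i<m. w v / (2 * real m) \<le> real (card {x\<in>nb v. c x = i})"
        using v(1,2) unfolding D_def mem_Collect_eq by (meson not_less)
      ultimately have "w v / (2 * real m) \<le> real (card (L v))" by simp
      \<comment> \<open>Splitting \<open>L v\<close> into integer halves costs at most 1/2; for
        \<open>w v \<ge> 8 * m\<close> this lowers the bound \<open>w v / (4 * m)\<close> to no less
        than \<open>3 * w v / (16 * m)\<close>.\<close>
      moreover have "8 * real m \<le> w v" using deg[OF v(1)] \<delta>8 by (simp add: w_def)
      ultimately have "3 * w v / (16 * real m) \<le> (real (card (L v)) - 1) / 2"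
        using m1 by (simp add: field_simps)
      moreover have "finite (L v)" using L_sub[OF v(1)] V(1) finite_subset by auto
      then have "card (Y v) = card (L v) - card (X v)"
        unfolding Y_def using X(1)[of v] by (simp add: card_Diff_subset finite_subset)
      then have "card (L v) \<le> 2 * card (X v) + 1" "card (X v) \<le> card (Y v)"
        using X(2)[of v] by linarith+
      then have "real (card (L v)) \<le> 2 * real (card (X v)) + 1" "real (card (X v)) \<le> real (card (Y v))"
        by linarith+
      then have "t \<le> real (card (X v)) \<and> t \<le> real (card (Y v))"
        if "t \<le> (real (card (L v)) - 1) / 2" for t
        using that by auto
      ultimately show ?thesis by blast
    qed
    show "(17 * real m) ^ k * (sum w (D \<inter> V) + 48 * real m * real (card V)) < sum w {v \<in> V. c v = k}"
    proof -
      have "D \<inter> V = D" by (auto simp: D_def)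
      then show ?thesis using top by (simp add: D_def n_def)
    qed
    show "c v \<le> k" if "v \<in> V" for v using PiE_mem[OF c that] by (simp add: m_def)
    show "p = K / (\<delta> / (32 * real m))\<^sup>2" "(\<delta> / (32 * real m))\<^sup>2 < K ^ 2 ^ k"
      using K p by (simp_all add: \<eta>_def m_def add.commute)
  qed (use \<delta>0 m1 K p tail in auto)
  then obtain W where W: "W \<subseteq> V" "W \<noteq> {}" "card W \<le> M * (1 + 8 * 2 ^ k)"
    "2 * card W \<le> (\<Sum>v\<in>W. card (N v \<inter> W))" by blast
  have finW: "finite W" using W(1) V(1) finite_subset by auto
  have "(\<Sum>v\<in>W. card (N v \<inter> W)) = card (SIGMA v:W. N v \<inter> W)"
    using finW by (simp add: card_SigmaI)
  \<comment> \<open>The colours orient every kept edge, so no unordered pair is counted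
    twice.\<close>
  also have "\<dots> = card ((\<lambda>(v, x). {v, x}) ` (SIGMA v:W. N v \<inter> W))"
  proof (rule card_image[symmetric], rule inj_onI, clarify)
    fix v x v' x'
    assume *: "v \<in> W" "x \<in> N v" "v' \<in> W" "x' \<in> N v'" "{v, x} = {v', x'}"
    then have "c v = Suc (c x)" "c v' = Suc (c x')" using N_level W(1) by blast+
    then show "v = v' \<and> x = x'" using *(5) by (auto simp: doubleton_eq_iff)
  qed
  also have "\<dots> \<le> card {{v, x} |v x. v \<in> W \<and> x \<in> W \<and> x \<in> nb v}"
  proof (rule card_mono)
    show "finite {{v, x} |v x. v \<in> W \<and> x \<in> W \<and> x \<in> nb v}"
      by (rule finite_subset[of _ "Pow W"]) (use finW in auto)
    show "(\<lambda>(v, x). {v, x}) ` (SIGMA v:W. N v \<inter> W) \<subseteq> {{v, x} |v x. v \<in> W \<and> x \<in> W \<and> x \<in> nb v}"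
      by (auto simp: NL L_def)
  qed
  finally show ?thesis using W by (intro exI[of _ W]) auto
qed

text \<open>Take a smallest nonempty \<open>U\<close> spanning at least
  \<open>\<delta> * card U\<close> edges: removing a vertex of degree below \<open>\<delta>\<close>
  would preserve this.\<close>

lemma ex_min_degree_subgraph:
  fixes \<delta> :: real
  assumes "finite V" "V \<noteq> {}" "E \<subseteq> nsets V 2" "0 < \<delta>" "\<delta> * real (card V) \<le> real (card E)"
  shows "\<exists>U\<subseteq>V. U \<noteq> {} \<and> (\<forall>v\<in>U. \<delta> \<le> real (card {x\<in>U. {v, x} \<in> E}))"
proof -
  let ?Q = "\<lambda>U. U \<subseteq> V \<and> U \<noteq> {} \<and> \<delta> * real (card U) \<le> real (card (E \<inter> Pow U))"
  have "E \<inter> Pow V = E" using assms(3) by (auto simp: nsets_def)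
  then have "?Q V" using assms by simp
  then obtain U where U: "?Q U" and least: "\<And>Z. ?Q Z \<Longrightarrow> card U \<le> card Z"
    using ex_has_least_nat[of ?Q V card] by blast
  have finU: "finite U" using U assms(1) finite_subset by auto
  have "\<delta> \<le> real (card {x\<in>U. {v, x} \<in> E})" if v: "v \<in> U" for v
  proof -
    let ?Z = "U - {v}"
    have "E \<inter> Pow U \<subseteq> (E \<inter> Pow ?Z) \<union> (\<lambda>x. {v, x}) ` {x\<in>U. {v, x} \<in> E}"
    proof
      fix e assume e: "e \<in> E \<inter> Pow U"
      show "e \<in> (E \<inter> Pow ?Z) \<union> (\<lambda>x. {v, x}) ` {x\<in>U. {v, x} \<in> E}"
      proof (cases "v \<in> e")
        case True
        have "card e = 2" using e assms(3) by (auto simp: nsets_def)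
        then obtain x where "e = {v, x}"
          using True by (auto simp: card_2_iff)
        then show ?thesis using e by auto
      qed (use e in auto)
    qed
    then have "card (E \<inter> Pow U) \<le> card ((E \<inter> Pow ?Z) \<union> (\<lambda>x. {v, x}) ` {x\<in>U. {v, x} \<in> E})"
      using finU by (intro card_mono) auto
    also have "\<dots> \<le> card (E \<inter> Pow ?Z) + card ((\<lambda>x. {v, x}) ` {x\<in>U. {v, x} \<in> E})"
      by (rule card_Un_le)
    also have "card ((\<lambda>x. {v, x}) ` {x\<in>U. {v, x} \<in> E}) \<le> card {x\<in>U. {v, x} \<in> E}"
      using finU by (intro card_image_le) auto
    finally have le: "card (E \<inter> Pow U) \<le> card (E \<inter> Pow ?Z) + card {x\<in>U. {v, x} \<in> E}" by simp
    have lt: "card ?Z < card U" using v finU by (meson card_Diff1_less)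
    have "real (card (E \<inter> Pow ?Z)) \<le> \<delta> * real (card ?Z)"
    \<comment> \<open>Minimality concerns nonempty sets only, so a one-vertex \<open>U\<close> is
      treated apart.\<close>
    proof (cases "?Z = {}")
      case True
      have "{} \<notin> E" using assms(3) by (auto simp: nsets_def)
      with True have "E \<inter> Pow ?Z = {}" by (metis Int_insert_right_if0 Pow_empty inf_bot_right)
      then show ?thesis using assms(4) by simp
    next
      case False
      then have "\<not> \<delta> * real (card ?Z) \<le> real (card (E \<inter> Pow ?Z))"
        using least[of ?Z] lt U by auto
      then show ?thesis by simp
    qed
    moreover have "real (card ?Z) = real (card U) - 1"
      using card.remove[OF finU v] by linarith
    moreover have "\<delta> * real (card U) \<le> real (card (E \<inter> Pow ?Z)) + real (card {x\<in>U. {v, x} \<in> E})"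
    proof -
      have "\<delta> * real (card U) \<le> real (card (E \<inter> Pow U))" using U by blast
      then show ?thesis using le by linarith
    qed
    ultimately show ?thesis by (simp add: algebra_simps)
  qed
  then show ?thesis using U by blast
qed

text \<open>Each triple of \<open>F\<close> has two vertices in \<open>W\<close> and so adds at most
  one new vertex; the last assumption turns this vertex count into average degree 2.\<close>

lemma ex_dense_of_triples:
  fixes H :: "'a hypergraph"
  assumes "three_graph H" "W \<subseteq> verts H" "F \<subseteq> edges H" "finite F" "W \<noteq> {} \<or> F \<noteq> {}"
    and "\<And>e. e \<in> F \<Longrightarrow> 2 \<le> card (e \<inter> W)" "2 * (card W + card F) \<le> 3 * card F"
  shows "\<exists>H'. subhypergraph H' H \<and> verts H' \<noteq> {} \<and> card (verts H') \<le> card W + card F \<and> 2 \<le> avg_degree H'"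
proof -
  let ?V = "W \<union> \<Union>F"
  have finV: "finite (verts H)" and E: "edges H \<subseteq> nsets (verts H) 3"
    using assms(1) by (auto simp: three_graph_def)
  have sub: "?V \<subseteq> verts H" using assms(2,3) E by (auto simp: nsets_def)
  have fV: "finite ?V" using sub finV finite_subset by auto
  have card1: "card (e - W) \<le> 1" if "e \<in> F" for e
  proof -
    have "e \<in> nsets (verts H) 3" using that assms(3) E by auto
    then have "finite e" "card e = 3" by (auto simp: nsets_def)
    then show ?thesis using assms(6)[OF that] by (simp add: card_Diff_subset_Int)
  qed
  have "card ?V = card (W \<union> (\<Union>e\<in>F. e - W))" by (intro arg_cong[of _ _ card]) auto
  also have "\<dots> \<le> card W + (\<Sum>e\<in>F. card (e - W))"
    by (rule order.trans[OF card_Un_le add_left_mono[OF card_UN_le[OF assms(4)]]])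
  also have "\<dots> \<le> card W + card F"
    using sum_bounded_above[of F "\<lambda>e. card (e - W)" 1] card1 by simp
  finally have cV: "card ?V \<le> card W + card F" .
  have ne: "?V \<noteq> {}"
  proof (cases "W = {}")
    case True
    then obtain e where "e \<in> F" "2 \<le> card (e \<inter> W)" using assms(5,6) by blast
    then show ?thesis using True by simp
  qed simp
  have sg: "subhypergraph (?V, F) H"
    using sub assms(3) E fV by (auto simp: subhypergraph_def three_graph_def nsets_def)
  have "real (card ?V) > 0" using ne fV by (simp add: card_gt_0_iff)
  moreover have "2 * card ?V \<le> 3 * card F" using mult_le_mono2[OF cV] assms(7) by (rule order.trans)
  then have "real (2 * card ?V) \<le> real (3 * card F)" by (simp only: of_nat_le_iff)
  then have "2 * real (card ?V) \<le> 3 * real (card F)" by simp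
  ultimately have "2 \<le> avg_degree (?V, F)" by (simp add: avg_degree_def field_simps)
  then show ?thesis using sg ne cV by (intro exI[of _ "(?V, F)"]) auto
qed

text \<open>Reduction to graphs. The minimum degree obtained is \<open>d / 9\<close>: one factor 3
  comes from the definition of the average degree, the other from at most three triples sharing a
  chosen pair. Hence \<open>288 = 9 * 32\<close>.\<close>

lemma dense_subhypergraph:
  fixes H :: "'a hypergraph" and d K p :: real and k n M :: nat
  defines "\<eta> \<equiv> d / (288 * (real k + 1))"
  assumes H: "three_graph H" "card (verts H) = n" "d \<le> avg_degree H" and n: "0 < n"
    and d: "0 < d" "9 * (17 * (real k + 1)) ^ (k + 3) \<le> d"
    and K: "1 \<le> K" "\<eta>\<^sup>2 < K ^ (2 ^ k)" and p: "p = K / \<eta>\<^sup>2" "p \<le> 1"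
    and tail: "real n * (1 + 2 * p) ^ n \<le> p * 3 ^ M"
  shows "\<exists>H'. subhypergraph H' H \<and> verts H' \<noteq> {} \<and>
    card (verts H') \<le> max 6 (3 * (M * (1 + 8 * 2 ^ k))) \<and> 2 \<le> avg_degree H'"
proof -
  have finV: "finite (verts H)" and E3: "edges H \<subseteq> nsets (verts H) 3"
    using H by (auto simp: three_graph_def)
  have finE: "finite (edges H)"
    by (rule finite_subset[of _ "Pow (verts H)"]) (use E3 finV in \<open>auto simp: nsets_def\<close>)
  have V0: "verts H \<noteq> {}" using H n by auto
  show ?thesis
  proof (cases "\<exists>q\<in>nsets (verts H) 2. 4 \<le> card {e\<in>edges H. q \<subseteq> e}")
    case True
    then obtain q F where q: "q \<subseteq> verts H" "finite q" "card q = 2"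
      and F: "F \<subseteq> {e\<in>edges H. q \<subseteq> e}" "card F = 4"
      by (auto simp: nsets_def elim: obtain_subset_with_card_n)
    have "finite F" using F by (metis card.infinite zero_neq_numeral)
    moreover have "2 \<le> card (e \<inter> q)" if "e \<in> F" for e
    proof -
      have "e \<inter> q = q" using that F by auto
      then show ?thesis using q by simp
    qed
    \<comment> \<open>Four triples through a common pair span at most six vertices, so their average
      degree is at least \<open>3 * 4 / 6 = 2\<close>.\<close>
    ultimately have "\<exists>H'. subhypergraph H' H \<and> verts H' \<noteq> {} \<and>
        card (verts H') \<le> card q + card F \<and> 2 \<le> avg_degree H'"
      using q F by (intro ex_dense_of_triples H) auto
    then obtain H' where H': "subhypergraph H' H" "verts H' \<noteq> {}"
      "card (verts H') \<le> card q + card F" "2 \<le> avg_degree H'" by blast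
    have "card (verts H') \<le> 6" using H'(3) q F by simp
    with H' show ?thesis by (intro exI[of _ H']) auto
  next
    case False
    have "\<exists>q. q \<subseteq> e \<and> card q = 2" if "e \<in> edges H" for e
    proof -
      have "2 \<le> card e" using that E3 by (auto simp: nsets_def)
      then show ?thesis by (metis obtain_subset_with_card_n)
    qed
    then obtain q where q: "\<And>e. e \<in> edges H \<Longrightarrow> q e \<subseteq> e" "\<And>e. e \<in> edges H \<Longrightarrow> card (q e) = 2"
      by metis
    define E where "E = q ` edges H"
    have E2: "E \<subseteq> nsets (verts H) 2"
    proof
      fix r assume "r \<in> E"
      then obtain e where e: "e \<in> edges H" "r = q e" by (auto simp: E_def)
      then have "q e \<subseteq> verts H" using q(1)[OF e(1)] E3 by (auto simp: nsets_def)
      then show "r \<in> nsets (verts H) 2"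
        using e q(2)[OF e(1)] finV by (auto simp: nsets_def intro: finite_subset)
    qed
    have finE': "finite E" using finE by (simp add: E_def)
    have "card (edges H) = (\<Sum>r\<in>E. card {e\<in>edges H. q e = r})"
    proof -
      have "edges H = (\<Union>r\<in>E. {e\<in>edges H. q e = r})" by (auto simp: E_def)
      then have "card (edges H) = card (\<Union>r\<in>E. {e\<in>edges H. q e = r})" by simp
      also have "\<dots> = (\<Sum>r\<in>E. card {e\<in>edges H. q e = r})"
        using finE finE' by (intro card_UN_disjoint) auto
      finally show ?thesis .
    qed
    also have "\<dots> \<le> (\<Sum>r\<in>E. 3)"
    proof (rule sum_mono)
      fix r assume r: "r \<in> E"
      have "card {e\<in>edges H. q e = r} \<le> card {e\<in>edges H. r \<subseteq> e}"
        using finE q(1) by (intro card_mono) auto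
      also have "\<dots> < 4" using False r E2 by (meson not_le subsetD)
      finally show "card {e\<in>edges H. q e = r} \<le> 3" by simp
    qed
    finally have "card (edges H) \<le> 3 * card E" by simp
    moreover have "d * real n \<le> 3 * real (card (edges H))"
      using H n by (simp add: avg_degree_def field_simps)
    ultimately have "d / 9 * real (card (verts H)) \<le> real (card E)" using H(2) by simp
    then obtain U where U: "U \<subseteq> verts H" "U \<noteq> {}"
      and deg: "\<And>v. v \<in> U \<Longrightarrow> d / 9 \<le> real (card {x\<in>U. {v, x} \<in> E})"
      using ex_min_degree_subgraph[OF finV V0 E2, of "d / 9"] d by auto
    have finU: "finite U" using U finV finite_subset by auto
    have Un: "card U \<le> n" using U finV H(2) card_mono by blast
    have \<eta>: "\<eta> = d / 9 / (32 * (real k + 1))" by (simp add: \<eta>_def)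
    have "\<eta> > 0" unfolding \<eta>_def using d by (intro divide_pos_pos) auto
    then have p0: "p > 0" using p K by simp
    have "(1 + 2 * p) ^ card U \<le> (1 + 2 * p) ^ n" using Un p0 by (intro power_increasing) auto
    then have "real (card U) * (1 + 2 * p) ^ card U \<le> real n * (1 + 2 * p) ^ n"
      using Un p0 by (intro mult_mono) auto
    then have tailU: "real (card U) * (1 + 2 * p) ^ card U \<le> p * 3 ^ M" using tail by simp
    obtain W where W: "W \<subseteq> U" "W \<noteq> {}" "card W \<le> M * (1 + 8 * 2 ^ k)"
      "2 * card W \<le> card {{v, x} |v x. v \<in> W \<and> x \<in> W \<and> x \<in> {x\<in>U. {v, x} \<in> E}}"
      using dense_subgraph_of_min_degree[of U "\<lambda>v. {x\<in>U. {v, x} \<in> E}" "d / 9" k K p M]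
        finU U(2) deg d(2) K p tailU unfolding \<eta> by (auto simp: insert_commute)
    have finW: "finite W" using W(1) finU finite_subset by auto
    define P where "P = {{v, x} |v x. v \<in> W \<and> x \<in> W \<and> x \<in> {x\<in>U. {v, x} \<in> E}}"
    have "P \<subseteq> q ` {e\<in>edges H. q e \<in> P}" by (auto simp: P_def E_def)
    then have "card P \<le> card (q ` {e\<in>edges H. q e \<in> P})" using finE by (intro card_mono) auto
    also have "\<dots> \<le> card {e\<in>edges H. q e \<in> P}" using finE by (intro card_image_le) auto
    finally have le: "2 * card W \<le> card {e\<in>edges H. q e \<in> P}" using W(4) by (simp add: P_def)
    \<comment> \<open>Taking exactly \<open>2 * card W\<close> triples limits the span to
      \<open>3 * card W\<close> vertices, which is precisely average degree 2 or more.\<close>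
    obtain F where F: "F \<subseteq> {e\<in>edges H. q e \<in> P}" "card F = 2 * card W"
      using obtain_subset_with_card_n[OF le] by blast
    have "2 \<le> card (e \<inter> W)" if e: "e \<in> F" for e
    proof -
      have "q e \<subseteq> e \<inter> W" using e F q(1)[of e] by (auto simp: P_def)
      then have "card (q e) \<le> card (e \<inter> W)" using finW by (intro card_mono) auto
      then show ?thesis using q(2)[of e] e F by auto
    qed
    then have "\<exists>H'. subhypergraph H' H \<and> verts H' \<noteq> {} \<and>
        card (verts H') \<le> card W + card F \<and> 2 \<le> avg_degree H'"
      using F W U finE by (intro ex_dense_of_triples H) (auto intro: finite_subset)
    then obtain H' where H': "subhypergraph H' H" "verts H' \<noteq> {}"
      "card (verts H') \<le> card W + card F" "2 \<le> avg_degree H'" by blast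
    have "card (verts H') \<le> 3 * (M * (1 + 8 * 2 ^ k))" using H'(3) F(2) W(3) by linarith
    with H' show ?thesis by (intro exI[of _ H']) auto
  qed
qed

section \<open>Choice of parameters and the polylogarithmic bound\<close>

lemma quadratic_le_power2: "8 \<le> j \<Longrightarrow> j * (j + 5) + 4 \<le> (2::nat) ^ j"
  by (induction j rule: dec_induct) (auto simp: algebra_simps)

lemma linear_le_power2: "8 \<le> j \<Longrightarrow> 17 * (j + 3) \<le> (2::nat) ^ j"
  by (induction j rule: dec_induct) auto

text \<open>Supplies the integer part \<open>j\<close> of the iterated binary logarithm of
  \<open>d\<close>, which determines the number of layers.\<close>

lemma ex_double_exponential_bracket:
  fixes d :: real
  assumes "2 ^ (2 ^ j0) \<le> d"
  shows "\<exists>j\<ge>j0. 2 ^ (2 ^ j) \<le> d \<and> d < 2 ^ (2 ^ Suc j)"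
proof -
  obtain i where i: "d < 2 ^ i" using real_arch_pow[of 2 d] by auto
  have "(2::real) ^ i \<le> 2 ^ (2 ^ i)" by (intro power_increasing) (auto intro: less_imp_le)
  with i have ex: "d < 2 ^ (2 ^ i)" by (rule order.strict_trans2)
  define J where "J = (LEAST i. d < 2 ^ (2 ^ i))"
  have J: "d < 2 ^ (2 ^ J)" unfolding J_def using ex by (rule LeastI)
  have "j0 < J"
  proof (rule ccontr)
    assume "\<not> j0 < J"
    then have "(2::real) ^ (2 ^ J) \<le> 2 ^ (2 ^ j0)" by (intro power_increasing) auto
    then have "d < d" using order.strict_trans2[OF order.strict_trans2[OF J] assms] by blast
    then show False by simp
  qed
  then obtain j where j: "J = Suc j" "j0 \<le> j" by (cases J) auto
  have "\<not> d < 2 ^ (2 ^ j)" using not_less_Least[of j "\<lambda>i. d < 2 ^ (2 ^ i)"] j J_def by auto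
  then show ?thesis using J j by (intro exI[of _ j]) auto
qed

lemma t3_le:
  assumes "\<And>H :: nat hypergraph. three_graph H \<Longrightarrow> card (verts H) = n \<Longrightarrow> d \<le> avg_degree H \<Longrightarrow>
    \<exists>H'. subhypergraph H' H \<and> verts H' \<noteq> {} \<and> card (verts H') \<le> t \<and> s \<le> avg_degree H'"
  shows "t3 n d s \<le> t"
  unfolding t3_def by (rule Least_le) (use assms in blast)

text \<open>With \<open>s = 2 ^ j\<close> of order \<open>ln d\<close>, the density \<open>p\<close>
  has order \<open>(j + 3) ^ 2 * s / d ^ 2\<close>, and the trees cost a further factor of order
  \<open>2 ^ k\<close>, again of order \<open>s\<close>. Bounding \<open>j + 3\<close> by
  \<open>s\<close> leaves \<open>s ^ 4\<close>, the fourth power of the logarithm.\<close>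

lemma t3_le_polylog:
  fixes d :: real
  assumes d: "2 ^ (2 ^ 8) \<le> d" and n: "d\<^sup>2 \<le> real n"
  shows "real (t3 n d 2) \<le> 6 + real n / d\<^sup>2 * (10 ^ 11 * ln d ^ 4)"
proof -
  obtain j where j: "8 \<le> j" "2 ^ (2 ^ j) \<le> d" "d < 2 ^ (2 ^ Suc j)"
    using ex_double_exponential_bracket[OF d] by blast
  define s where "s = (2::real) ^ j"
  define k where "k = j + 2"
  define K where "K = 5 * s"
  define \<eta> where "\<eta> = d / (288 * (real k + 1))"
  define p where "p = K / \<eta>\<^sup>2"
  have s1: "s \<ge> 1" by (simp add: s_def)
  have "(2::real) ^ 1 \<le> 2 ^ (2 ^ 8)" by (intro power_increasing) auto
  then have d2: "d \<ge> 2" using d by simp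
  have n0: "real n > 0" using n d2 by (smt (verit) zero_less_power)
  have lin: "17 * (real j + 3) \<le> s"
    using of_nat_mono[OF linear_le_power2[OF j(1)], where 'a = real] by (simp add: s_def)
  have k: "real k + 1 = real j + 3" "k + 3 = j + 5" by (simp_all add: k_def)
  have dk: "9 * (17 * (real k + 1)) ^ (k + 3) \<le> d"
  proof -
    have "9 * (17 * (real k + 1)) ^ (k + 3) \<le> 2 ^ 4 * s ^ (j + 5)"
      unfolding k using lin by (intro mult_mono power_mono) auto
    also have "\<dots> = 2 ^ (j * (j + 5) + 4)" by (simp add: s_def power_add power_mult)
    also have "\<dots> \<le> 2 ^ (2 ^ j)" using quadratic_le_power2[OF j(1)] by (intro power_increasing) auto
    finally show ?thesis using j(2) by simp
  qed
  have \<eta>0: "\<eta> > 0" unfolding \<eta>_def using d2 by (intro divide_pos_pos) auto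
  have p_eq: "p = 414720 * (real j + 3)\<^sup>2 * s / d\<^sup>2"
    unfolding p_def \<eta>_def K_def k power_divide power_mult_distrib by simp
  have p1: "p \<le> 1"
  proof -
    have "414720 * (real j + 3)\<^sup>2 * s \<le> 2 ^ 19 * s\<^sup>2 * s"
      using lin s1 by (intro mult_mono power_mono) auto
    also have "\<dots> = 2 ^ 19 * s ^ 3" by (simp add: power2_eq_square power3_eq_cube)
    also have "\<dots> = 2 ^ (j * 3 + 19)" by (simp add: s_def power_add power_mult)
    also have "\<dots> \<le> 2 ^ (2 ^ j)"
    proof (intro power_increasing)
      have "8 * j \<le> j * j" using j(1) by simp
      then show "j * 3 + 19 \<le> 2 ^ j" using quadratic_le_power2[OF j(1)] j(1) by (simp add: algebra_simps)
    qed auto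
    also have "\<dots> \<le> d" by (rule j(2))
    also have "\<dots> \<le> d\<^sup>2" using d2 by (simp add: power2_eq_square)
    finally show ?thesis unfolding p_eq using d2 by (simp add: field_simps)
  qed
  \<comment> \<open>Squaring \<open>d < 2 ^ (2 ^ Suc j)\<close> raises the outer exponent by one;
    this is why \<open>k = j + 2\<close>.\<close>
  have \<eta>K: "\<eta>\<^sup>2 < K ^ (2 ^ k)"
  proof -
    have "\<eta> \<le> d" unfolding \<eta>_def using d2 by (simp add: field_simps)
    then have "\<eta>\<^sup>2 \<le> d\<^sup>2" using \<eta>0 by (intro power_mono) auto
    also have "\<dots> < (2 ^ (2 ^ Suc j))\<^sup>2" using j(3) d2 by (intro power_strict_mono) auto
    also have "\<dots> = 2 ^ (2 ^ k)" by (simp add: k_def mult.commute flip: power_mult)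
    also have "\<dots> \<le> K ^ (2 ^ k)" using s1 by (intro power_mono) (auto simp: K_def)
    finally show ?thesis .
  qed
  define M where "M = nat \<lceil>4 * p * real n\<rceil>"
  have pK: "K / d\<^sup>2 \<le> p"
  proof -
    have "\<eta>\<^sup>2 \<le> d\<^sup>2" using \<eta>0 d2 unfolding \<eta>_def by (intro power_mono) (auto simp: field_simps)
    then show ?thesis unfolding p_def using \<eta>0 d2 s1 by (intro divide_left_mono) (auto simp: K_def)
  qed
  define x where "x = real n / d\<^sup>2"
  have x1: "x \<ge> 1" using n d2 by (simp add: x_def)
  have pn: "K * x \<le> p * real n"
    using mult_right_mono[OF pK, of "real n"] by (simp add: x_def)
  have p0: "p > 0" using p_def \<eta>0 s1 by (simp add: K_def)
  have Kx1: "1 \<le> K * x" using mult_mono[of 1 K 1 x] s1 x1 by (simp add: K_def)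
  have ln_d: "ln d \<le> 2 * s"
  proof -
    have "ln d \<le> ln (2 ^ (2 ^ Suc j))" using j(3) d2 by (subst ln_le_cancel_iff) auto
    also have "\<dots> = 2 * s * ln 2" by (simp add: ln_realpow s_def)
    also have "\<dots> \<le> 2 * s * 1" using s1 ln_2_less_1 by (intro mult_left_mono) auto
    finally show ?thesis by simp
  qed
  \<comment> \<open>The 5 in \<open>K = 5 * s\<close> is used here: \<open>ln x\<close> contributes
    at most \<open>s * x\<close> and \<open>2 * ln d\<close> at most
    \<open>4 * s * x\<close>.\<close>
  have ln_n: "ln (real n) \<le> p * real n"
  proof -
    have "real n = x * d\<^sup>2" using d2 by (simp add: x_def)
    then have "ln (real n) = ln x + 2 * ln d" using x1 d2 by (simp add: ln_mult ln_realpow)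
    also have "\<dots> \<le> x * 1 + 4 * (s * 1)" using ln_le_minus_one[of x] x1 ln_d by simp
    also have "\<dots> \<le> x * s + 4 * (s * x)" using x1 s1 by (intro add_mono mult_left_mono) auto
    also have "\<dots> = K * x" by (simp add: K_def)
    finally show ?thesis using pn by simp
  qed
  \<comment> \<open>The factor 4 in \<open>M\<close> splits as \<open>2 + 1 + 1\<close>: two units
    of \<open>p * n\<close> for the exponential moment, one for the factor \<open>n\<close>, and one
    to leave a factor at most \<open>1 / n\<close>, hence at most \<open>p\<close>.\<close>
  have tail: "real n * (1 + 2 * p) ^ n \<le> p * 3 ^ M"
  proof -
    have "real n * (1 + 2 * p) ^ n \<le> real n * exp (2 * p) ^ n"
      using p0 by (intro mult_left_mono power_mono exp_ge_add_one_self) auto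
    also have "\<dots> = real n * exp (2 * p * real n)"
      by (simp add: exp_of_nat_mult[symmetric] mult.commute)
    also have "\<dots> = exp (ln (real n)) * exp (2 * p * real n)" using n0 by simp
    also have "\<dots> \<le> exp (p * real n) * exp (2 * p * real n)" using ln_n by simp
    also have "\<dots> = exp (4 * p * real n) * exp (- (p * real n))"
      by (simp flip: exp_add)
    also have "\<dots> \<le> 3 ^ M * p"
    proof (intro mult_mono)
      have "exp (4 * p * real n) \<le> exp (real M)" unfolding M_def by (simp, linarith)
      also have "\<dots> = exp 1 ^ M" by (simp flip: exp_of_nat_mult)
      also have "\<dots> \<le> 3 ^ M" using exp_le by (intro power_mono) auto
      finally show "exp (4 * p * real n) \<le> 3 ^ M" .
      have "exp (- (p * real n)) \<le> exp (- ln (real n))" using ln_n by simp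
      also have "\<dots> = 1 / real n" using n0 by (simp add: exp_minus inverse_eq_divide)
      also have "\<dots> \<le> p" using pn Kx1 n0 by (simp add: field_simps)
      finally show "exp (- (p * real n)) \<le> p" .
    qed auto
    finally show ?thesis by (simp add: mult.commute)
  qed
  have "t3 n d 2 \<le> max 6 (3 * (M * (1 + 8 * 2 ^ k)))"
  proof (rule t3_le)
    fix H :: "nat hypergraph"
    assume "three_graph H" "card (verts H) = n" "d \<le> avg_degree H"
    then show "\<exists>H'. subhypergraph H' H \<and> verts H' \<noteq> {} \<and>
      card (verts H') \<le> max 6 (3 * (M * (1 + 8 * 2 ^ k))) \<and> 2 \<le> avg_degree H'"
      using n0 d2 dk s1 \<eta>K p1 tail
      by (intro dense_subhypergraph[where d = d and K = K and p = p])
        (auto simp: \<eta>_def p_def K_def)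
  qed
  also have "\<dots> \<le> 6 + 3 * (M * (1 + 8 * 2 ^ k))" by simp
  finally have "real (t3 n d 2) \<le> real (6 + 3 * (M * (1 + 8 * 2 ^ k)))" by (simp only: of_nat_le_iff)
  also have "\<dots> = 6 + 3 * (real M * (1 + 32 * s))" by (simp add: k_def s_def algebra_simps)
  also have "3 * (real M * (1 + 32 * s)) \<le> 3 * (5 * (p * real n) * (33 * s))"
  proof (intro mult_left_mono mult_mono)
    have "0 \<le> 4 * p * real n" using p0 by simp
    then have "real M = of_int \<lceil>4 * p * real n\<rceil>" unfolding M_def by (intro of_nat_nat) simp
    then have "real M \<le> 4 * p * real n + 1" using of_int_ceiling_le_add_one[of "4 * p * real n"] by simp
    then show "real M \<le> 5 * (p * real n)" using pn Kx1 by simp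
  qed (use s1 p0 in auto)
  \<comment> \<open>\<open>205286400 = 3 * 5 * 33 * 414720\<close>, where
    \<open>414720 = 5 * 288 ^ 2\<close> comes from \<open>p\<close>.\<close>
  also have "\<dots> = x * (205286400 * (s\<^sup>2 * (real j + 3)\<^sup>2))"
    by (simp add: p_eq x_def power2_eq_square field_simps)
  also have "\<dots> \<le> x * (205286400 * (s\<^sup>2 * s\<^sup>2))"
    using lin x1 s1 by (intro mult_left_mono power_mono) auto
  also have "\<dots> \<le> x * (10 ^ 11 * ln d ^ 4)"
  proof -
    have "1 / 2 \<le> (ln 2 :: real)" using ln_le_minus_one[of "1 / 2 :: real"] by (simp add: ln_div)
    then have "s * (1 / 2) \<le> s * ln 2" using s1 by (intro mult_left_mono) auto
    also have "\<dots> = ln (2 ^ (2 ^ j))" by (simp add: ln_realpow s_def)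
    also have "\<dots> \<le> ln d" using j(2) d2 by (subst ln_le_cancel_iff) auto
    finally have "s \<le> 2 * ln d" by simp
    then have "s ^ 4 \<le> (2 * ln d) ^ 4" using s1 by (intro power_mono) auto
    then have "205286400 * s ^ 4 \<le> 3284582400 * ln d ^ 4" by (simp add: power_mult_distrib)
    also have "\<dots> \<le> 10 ^ 11 * ln d ^ 4" by (intro mult_right_mono) auto
    finally have "205286400 * s ^ 4 \<le> 10 ^ 11 * ln d ^ 4" .
    moreover have "s\<^sup>2 * s\<^sup>2 = s ^ 4" by (simp flip: power_add)
    ultimately show ?thesis using x1 by (simp add: mult_left_mono)
  qed
  finally show ?thesis by (simp add: x_def)
qed

text \<open>The exponent obtained is \<open>C = 4\<close>, for all \<open>n \<ge> 1\<close>. Near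
  \<open>d = 2\<close> the logarithm is below 1 and its high powers are small, so a constant factor
  \<open>A\<close> accompanies the power.\<close>

theorem corollary6:
  "\<exists>A C :: real. \<exists>N :: nat. \<forall>n \<ge> N. \<forall>d :: real.
     2 \<le> d \<and> d \<le> real n powr (1 / 2) \<longrightarrow>
     real (t3 n d 2) \<le> real n * d powr (-2) * (A * ln d powr C)"
proof -
  define d0 :: real where "d0 = 2 ^ (2 ^ 8)"
  \<comment> \<open>Chosen so that \<open>A0 * ln d ^ 4\<close> is at least
    \<open>6 + d0 ^ 2\<close> from \<open>d = 2\<close> on: the 6 covers the additive term for large
    \<open>d\<close>, and \<open>d0 ^ 2\<close> the whole range \<open>d < d0\<close>.\<close>
  define A0 :: real where "A0 = (6 + (d0)\<^sup>2) / ln 2 ^ 4"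
  have "real (t3 n d 2) \<le> real n * d powr (-2) * ((10 ^ 11 + A0) * ln d powr 4)"
    if n: "1 \<le> n" and d: "2 \<le> d" "d \<le> real n powr (1 / 2)" for n :: nat and d :: real
  proof -
    have ln2: "0 < (ln 2 :: real)" by simp
    have lnd: "ln 2 \<le> ln d" using d by simp
    then have ln4: "0 < (ln 2 :: real) ^ 4" "ln 2 ^ 4 \<le> ln d ^ 4" using ln2 by (auto intro: power_mono)
    have A0: "A0 * ln d ^ 4 \<ge> 6 + (d0)\<^sup>2"
    proof -
      have "(6 + d0\<^sup>2) * ln 2 ^ 4 \<le> (6 + d0\<^sup>2) * ln d ^ 4" using ln4(2) by (intro mult_left_mono) auto
      then show ?thesis unfolding A0_def using ln4(1) by (simp add: pos_le_divide_eq)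
    qed
    have "d\<^sup>2 \<le> (real n powr (1 / 2))\<^sup>2" using d by (intro power_mono) auto
    also have "\<dots> = real n" using n by (simp add: powr_half_sqrt)
    finally have dn: "d\<^sup>2 \<le> real n" .
    have x1: "1 \<le> real n / d\<^sup>2" using dn d by simp
    have "real (t3 n d 2) \<le> real n / d\<^sup>2 * ((10 ^ 11 + A0) * ln d ^ 4)"
    proof (cases "d0 \<le> d")
      case True
      have "1 * 6 \<le> real n / d\<^sup>2 * (A0 * ln d ^ 4)"
      proof (intro mult_mono)
        show "6 \<le> A0 * ln d ^ 4" using A0 zero_le_power2[of d0] by linarith
      qed (use x1 in auto)
      then show ?thesis using t3_le_polylog[OF True[unfolded d0_def] dn] by (simp only: distrib_left distrib_right)
    next
      case False
      \<comment> \<open>For bounded \<open>d\<close> the trivial bound suffices: \<open>H\<close>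
        itself already has average degree at least 2.\<close>
      have "t3 n d 2 \<le> n"
      proof (rule t3_le)
        fix H :: "nat hypergraph"
        assume "three_graph H" "card (verts H) = n" "d \<le> avg_degree H"
        then show "\<exists>H'. subhypergraph H' H \<and> verts H' \<noteq> {} \<and> card (verts H') \<le> n \<and> 2 \<le> avg_degree H'"
          using n d by (intro exI[of _ H]) (auto simp: subhypergraph_def)
      qed
      then have "real (t3 n d 2) \<le> real n / d\<^sup>2 * d\<^sup>2" using d by simp
      also have "\<dots> \<le> real n / d\<^sup>2 * ((10 ^ 11 + A0) * ln d ^ 4)"
      proof (intro mult_left_mono)
        have "d\<^sup>2 \<le> (d0)\<^sup>2" using False d by (intro power_mono) auto
        also have "\<dots> \<le> 10 ^ 11 * ln d ^ 4 + A0 * ln d ^ 4" using A0 ln4(1,2) by (intro add_increasing) auto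
        finally show "d\<^sup>2 \<le> (10 ^ 11 + A0) * ln d ^ 4" by (simp only: distrib_right)
      qed auto
      finally show ?thesis .
    qed
    moreover have "d powr (-2) = 1 / d\<^sup>2"
      using d by (simp add: powr_minus_divide)
    moreover have "ln d powr 4 = ln d ^ 4" using less_le_trans[OF ln2 lnd] by simp
    ultimately show ?thesis by (simp only: times_divide_eq_right mult_1_right)
  qed
  then show ?thesis by blast
qed

end
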